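(* Let $F$ be an Orlicz function satisfying the $\Delta_2$-condition. Then the following are equivalent: (1) $F$ is elastic at $\infty$; (2) $L_F[0,1]$ is stretchable; (3) $L_F[0,1]$ is compressible; (4) $L_F[0,1]$ is elastic.
   Context: **Orlicz functions.** An Orlicz function is a continuous strictly increasing convex function $F:[0,\infty)\to[0,\infty)$ with $F(0)=0$. It satisfies the $\Delta_2$-condition if there is a constant $\Delta$ with $F(2x)\le\Delta F(x)$ for all $x\ge0$. $L_F[0,1]$ is the space of measurable $f$ on $[0,1]$ (Lebesgue measure) with $\|f\|_{L_F}=\inf\{\alpha>0:\int_0^1F(\alpha^{-1}|f(t)|)\,dt\le1\}<\infty$. **Elasticity at $\infty$.** Put $F_t(x)=F(tx)/F(t)$. For $C>1$ and $0<x\le1$, let $\Phi_+^\infty(x,C)$ be the supremum of all $n$ such that there exist $1\le a_1<b_1\le a_2<b_2\le\cdots\le a_n<b_n$ with $F_{b_k}(x)\ge CF_{a_k}(x)$ for $1\le k\le n$; let $\Phi_-^\infty(x,C)$ be the supremum of all $n$ such that there exist $1\le a_1<b_1\le\cdots\le a_n<b_n$ with $F_{a_k}(x)\ge CF_{b_k}(x)$ for $1\le k\le n$. $F$ is elastic at $\infty$ if there exist $C_0,C_1>1$ and $r>0$ such that $\Phi_+^\infty(x,C_0)+\Phi_-^\infty(x,C_0)\le C_1x^{-r}$ for all $0<x\le1$. **Stretchable, compressible, elastic spaces.** For a rearrangement-invariant space $X$ on $[0,1]$ (such as $L_F[0,1]$), let $\mathbb Z_-=\{n\in\mathbb Z:n<0\}$,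 $e_n=\chi_{[2^n,2^{n+1})}$ for $n\in\mathbb Z_-$, and let $E_X$ be the space of real sequences $x=(x(n))_{n\in\mathbb Z_-}$ with $\|x\|_{E_X}=\|\sum_{n\in\mathbb Z_-}x(n)e_n\|_X<\infty$. For sets of integers write $A<B$ if $a<b$ for all $a\in A,b\in B$. If $I$ is an interval of $\mathbb Z$, a pair $(x_n,y_n)_{n\in I}$ of sequences of finitely supported elements of $E_X$ is interlaced if $\operatorname{supp}x_n<\operatorname{supp}y_n$ for $n\in I$ and $\operatorname{supp}y_n<\operatorname{supp}x_{n+1}$ whenever $n,n+1\in I$. A sequence space $E$ has the right-shift property (RSP) if there is a constant $C$ such that for every interlaced pair with $\|y_n\|_E\le\|x_n\|_E=1$ $(n\in I)$ and every finitely nonzero scalar sequence $(\alpha_n)_{n\in I}$, $\|\sum_n\alpha_ny_n\|_E\le C\|\sum_n\alpha_nx_n\|_E$. It has the left-shift property (LSP) if there is a constant $C'$ such that for every interlaced pair with $\|x_n\|_E\le\|y_n\|_E=1$ and every finitely nonzero $(\alpha_n)$, $\|\sum_n\alpha_nx_n\|_E\le C'\|\sum_n\alpha_ny_n\|_E$. $X$ is stretchable if $E_X$ has (RSP), compressible if $E_X$ has (LSP), and elastic if it is both.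
   Formalization: In an interlaced pair the blocks supp x_n ∪ supp y_n are also required to be ordered successively for all m < n (automatic if no vector is zero); otherwise a zero vector would let blocks overlap and no space L_F[0,1] would be stretchable or compressible. *)

theory Defs
  imports "HOL-Analysis.Analysis"
begin

(* Orlicz functions are functions on all of the reals of which only the restriction to
   [0, \<infinity>) is used; nonnegativity there follows from monotonicity and F 0 = 0. *)
definition orlicz_function :: "(real \<Rightarrow> real) \<Rightarrow> bool" where
  "orlicz_function F \<longleftrightarrow>
     continuous_on {0..} F \<and> strict_mono_on {0..} F \<and> convex_on {0..} F \<and> F 0 = 0"

definition delta2 :: "(real \<Rightarrow> real) \<Rightarrow> bool" where
  "delta2 F \<longleftrightarrow> (\<exists>\<Delta>::real. \<forall>x\<ge>0. F (2 * x) \<le> \<Delta> * F x)"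

(* A function space on [0,1] is represented by its extended norm, with value \<infinity> exactly
   off the space (in particular on nonmeasurable functions).  The infimum of the empty
   set is \<infinity>. *)
definition orlicz_norm :: "(real \<Rightarrow> real) \<Rightarrow> (real \<Rightarrow> real) \<Rightarrow> ennreal" where
  "orlicz_norm F f =
     (if f \<in> borel_measurable (lebesgue_on {0..1})
      then Inf {ennreal \<alpha> | \<alpha>. \<alpha> > 0 \<and>
             (\<integral>\<^sup>+ t. ennreal (F (inverse \<alpha> * \<bar>f t\<bar>)) \<partial>lebesgue_on {0..1}) \<le> 1}
      else \<infinity>)"

definition dilate :: "(real \<Rightarrow> real) \<Rightarrow> real \<Rightarrow> real \<Rightarrow> real" where
  "dilate F t x = F (t * x) / F t"

definition interval_chain :: "nat \<Rightarrow> (nat \<Rightarrow> real) \<Rightarrow> (nat \<Rightarrow> real) \<Rightarrow> bool" where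
  "interval_chain n a b \<longleftrightarrow>
     1 \<le> a 1 \<and> (\<forall>k\<in>{1..n}. a k < b k) \<and> (\<forall>k\<in>{1..<n}. b k \<le> a (Suc k))"

definition Phi_plus_inf :: "(real \<Rightarrow> real) \<Rightarrow> real \<Rightarrow> real \<Rightarrow> enat" where
  "Phi_plus_inf F x C =
     Sup {enat n | n. \<exists>a b. interval_chain n a b \<and>
            (\<forall>k\<in>{1..n}. dilate F (b k) x \<ge> C * dilate F (a k) x)}"

definition Phi_minus_inf :: "(real \<Rightarrow> real) \<Rightarrow> real \<Rightarrow> real \<Rightarrow> enat" where
  "Phi_minus_inf F x C =
     Sup {enat n | n. \<exists>a b. interval_chain n a b \<and>
            (\<forall>k\<in>{1..n}. dilate F (a k) x \<ge> C * dilate F (b k) x)}"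

definition elastic_at_infinity :: "(real \<Rightarrow> real) \<Rightarrow> bool" where
  "elastic_at_infinity F \<longleftrightarrow>
     (\<exists>C\<^sub>0 C\<^sub>1 r :: real. C\<^sub>0 > 1 \<and> C\<^sub>1 > 1 \<and> r > 0 \<and>
        (\<forall>x. 0 < x \<and> x \<le> 1 \<longrightarrow>
           ereal_of_enat (Phi_plus_inf F x C\<^sub>0 + Phi_minus_inf F x C\<^sub>0)
             \<le> ereal (C\<^sub>1 * x powr (- r))))"

(* Sequences indexed by the negative integers are functions on int whose values at
   nonnegative arguments are irrelevant.  At each t at most one term of the sum below is
   nonzero. *)
definition step_function :: "(int \<Rightarrow> real) \<Rightarrow> real \<Rightarrow> real" where
  "step_function x t =
     (\<Sum>\<^sub>\<infinity>n\<in>{..<0}. x n * indicator {2 powi n ..< 2 powi (n + 1)} t)"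

definition seq_norm :: "((real \<Rightarrow> real) \<Rightarrow> ennreal) \<Rightarrow> (int \<Rightarrow> real) \<Rightarrow> ennreal" where
  "seq_norm X x = X (step_function x)"

definition seq_space :: "((real \<Rightarrow> real) \<Rightarrow> ennreal) \<Rightarrow> (int \<Rightarrow> real) set" where
  "seq_space X = {x. seq_norm X x < \<infinity>}"

abbreviation supp :: "(int \<Rightarrow> real) \<Rightarrow> int set" where
  "supp \<equiv> support_on {..<0}"

definition set_before :: "int set \<Rightarrow> int set \<Rightarrow> bool" where
  "set_before A B \<longleftrightarrow> (\<forall>a\<in>A. \<forall>b\<in>B. a < b)"

definition int_interval :: "int set \<Rightarrow> bool" where
  "int_interval I \<longleftrightarrow> (\<forall>a\<in>I. \<forall>b\<in>I. {a..b} \<subseteq> I)"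

(* set_before is vacuous for empty sets.  The last clause follows from the two before it
   when all supports are nonempty; it makes a zero vector in the family unable to break
   the chain supp x_n < supp y_n < supp x_(n+1) < ...  Without it, taking some y_n = 0
   would allow overlapping x_n, and no space would have the right-shift property. *)
definition interlaced ::
  "((real \<Rightarrow> real) \<Rightarrow> ennreal) \<Rightarrow> int set \<Rightarrow> (int \<Rightarrow> int \<Rightarrow> real) \<Rightarrow> (int \<Rightarrow> int \<Rightarrow> real) \<Rightarrow> bool" where
  "interlaced X I x y \<longleftrightarrow>
     (\<forall>n\<in>I. x n \<in> seq_space X \<and> finite (supp (x n)) \<and>
            y n \<in> seq_space X \<and> finite (supp (y n))) \<and>
     (\<forall>n\<in>I. set_before (supp (x n)) (supp (y n))) \<and>
     (\<forall>n. n \<in> I \<and> n + 1 \<in> I \<longrightarrow> set_before (supp (y n)) (supp (x (n + 1)))) \<and>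
     (\<forall>m\<in>I. \<forall>n\<in>I. m < n \<longrightarrow>
        set_before (supp (x m) \<union> supp (y m)) (supp (x n) \<union> supp (y n)))"

definition lin_comb :: "int set \<Rightarrow> (int \<Rightarrow> real) \<Rightarrow> (int \<Rightarrow> int \<Rightarrow> real) \<Rightarrow> int \<Rightarrow> real" where
  "lin_comb I \<alpha> x k = (\<Sum>n\<in>{n\<in>I. \<alpha> n \<noteq> 0}. \<alpha> n * x n k)"

(* The right-shift property of the sequence space of X. *)
definition stretchable :: "((real \<Rightarrow> real) \<Rightarrow> ennreal) \<Rightarrow> bool" where
  "stretchable X \<longleftrightarrow>
     (\<exists>C::real. C > 0 \<and>
        (\<forall>I x y \<alpha>.
           int_interval I \<and> interlaced X I x y \<and>
           (\<forall>n\<in>I. seq_norm X (y n) \<le> seq_norm X (x n) \<and> seq_norm X (x n) = 1) \<and>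
           finite {n\<in>I. \<alpha> n \<noteq> 0} \<longrightarrow>
           seq_norm X (lin_comb I \<alpha> y) \<le> ennreal C * seq_norm X (lin_comb I \<alpha> x)))"

(* The left-shift property of the sequence space of X. *)
definition compressible :: "((real \<Rightarrow> real) \<Rightarrow> ennreal) \<Rightarrow> bool" where
  "compressible X \<longleftrightarrow>
     (\<exists>C::real. C > 0 \<and>
        (\<forall>I x y \<alpha>.
           int_interval I \<and> interlaced X I x y \<and>
           (\<forall>n\<in>I. seq_norm X (x n) \<le> seq_norm X (y n) \<and> seq_norm X (y n) = 1) \<and>
           finite {n\<in>I. \<alpha> n \<noteq> 0} \<longrightarrow>
           seq_norm X (lin_comb I \<alpha> x) \<le> ennreal C * seq_norm X (lin_comb I \<alpha> y)))"

definition elastic_space :: "((real \<Rightarrow> real) \<Rightarrow> ennreal) \<Rightarrow> bool" where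
  "elastic_space X \<longleftrightarrow> stretchable X \<and> compressible X"

end

(* Let e_k have height t_k in E_X, where F(t_k) = 2^(-k).  On finitely supported sequences the
   norm is governed by the modular, the sum of 2^k F |x_k|.  Up to constants, s |-> modular (s x)
   lies between the extreme values of F_t(s), where t ranges over the heights attached to the
   support of x.  Thus interlaced families compare values of t |-> F_t(s) over disjoint
   intervals.

   If F is elastic, passing from x to x^(1/m) makes the exponent r smaller than 1.  Since
   F_t(s) <= s, grouping the coefficients dyadically gives a convergent geometric series, which
   proves both shift properties.

   Conversely, either shift property applied to unit vectors bounds, polynomially in 1/x, the
   number of large changes of t |-> F_t(x) in one direction.  As log F_t(x) has range O(log (1/x)),
   this also bounds the number of large changes in the other direction. *)

theory Submission
  imports Defs
begin

section \<open>Disjoint intervals and elasticity\<close>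

text \<open>The exponent must be below 1 because, among coefficients of size about 2^(-i), there may
  be about 2^(i r) indices where the two families differ much, each contributing up to 2^(-i). It
  can be lowered since F_t(x y) = F_t(x) F_(t x)(y): thus F_t(x^m) is a product of m values F_(t
  x^i)(x), and a change of the product by more than C^m forces a change by C in some factor. The
  price is that the interval of t is multiplied by x^i and may fall below 1. This concerns only
  intervals starting at or below x^(-m), and these are logarithmically many, since under doubling a
  large change needs an interval whose right endpoint is more than twice the left one. Doubling also
  makes norm 1 the same as modular 1, and allows t to be rounded to heights of unit vectors. In the
  converse, a norm inequality with equal coefficients only says that a sum of small values not
  exceeding 1 keeps the sum of the large values bounded. A partial sum stopped between 1/2 and 1
  would violate this, so all small values together sum to at most 1, and the polynomial lower bound
  for F_t(x) counts them.\<close>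

definition separated :: "real \<Rightarrow> (real \<times> real) set \<Rightarrow> bool" where
  "separated c P \<longleftrightarrow> finite P \<and> (\<forall>p\<in>P. c \<le> fst p \<and> fst p < snd p) \<and>
     (\<forall>p\<in>P. \<forall>q\<in>P. p \<noteq> q \<longrightarrow> snd p \<le> fst q \<or> snd q \<le> fst p)"

lemma separated_subset: "separated c P \<Longrightarrow> Q \<subseteq> P \<Longrightarrow> separated c Q"
  unfolding separated_def by (meson finite_subset subsetD)

lemma interval_chain_le:
  assumes "interval_chain n a b" "1 \<le> k" "k < l" "l \<le> n"
  shows "b k \<le> a l"
  using assms(3,4)
proof (induction l rule: less_induct)
  case (less l)
  show ?case
  proof (cases "l = Suc k")
    case True
    then show ?thesis using assms(1,2) less.prems by (auto simp: interval_chain_def)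
  next
    case False
    define j where "j = l - 1"
    have l: "l = Suc j" "k < j" using False less.prems by (auto simp: j_def)
    have "b k \<le> a j" using less.IH[of j] l less.prems by auto
    also have "a j \<le> b j" using assms(1,2) l less.prems by (auto simp: interval_chain_def less_imp_le)
    also have "b j \<le> a l" using assms(1,2) l less.prems by (auto simp: interval_chain_def)
    finally show ?thesis .
  qed
qed

lemma interval_chain_less:
  assumes "interval_chain n a b" "k \<in> {1..n}"
  shows "a k < b k"
  using assms by (auto simp: interval_chain_def)

lemma interval_chain_ge_one:
  assumes "interval_chain n a b" "k \<in> {1..n}"
  shows "1 \<le> a k"
proof (cases "k = 1")
  case False
  then have "b 1 \<le> a k" using interval_chain_le[OF assms(1), of 1 k] assms(2) by auto
  moreover have "1 \<le> a 1" "a 1 < b 1" using assms by (auto simp: interval_chain_def)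
  ultimately show ?thesis by linarith
qed (use assms in \<open>auto simp: interval_chain_def\<close>)

lemma separated_of_interval_chain:
  assumes "interval_chain n a b"
  shows "separated 1 ((\<lambda>k. (a k, b k)) ` {1..n})" "card ((\<lambda>k. (a k, b k)) ` {1..n}) = n"
proof -
  have sep: "b k \<le> a l \<or> b l \<le> a k" if "k \<in> {1..n}" "l \<in> {1..n}" "k \<noteq> l" for k l
    using that interval_chain_le[OF assms, of k l] interval_chain_le[OF assms, of l k]
    by (cases "k < l") auto
  then show "separated 1 ((\<lambda>k. (a k, b k)) ` {1..n})"
    using interval_chain_less[OF assms] interval_chain_ge_one[OF assms]
    unfolding separated_def by auto (metis atLeastAtMost_iff One_nat_def)+
  have "inj_on (\<lambda>k. (a k, b k)) {1..n}"
  proof (rule inj_onI, rule ccontr)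
    fix k l assume *: "k \<in> {1..n}" "l \<in> {1..n}" "(a k, b k) = (a l, b l)" "k \<noteq> l"
    then show False using sep[OF *(1,2,4)] interval_chain_less[OF assms *(1)] by auto
  qed
  then show "card ((\<lambda>k. (a k, b k)) ` {1..n}) = n" by (simp add: card_image)
qed

text \<open>Induction on the number of intervals: one with the largest left endpoint becomes the
  last. Families are otherwise kept as unordered sets of pairs, because subfamilies and images under
  scaling are needed and an indexed chain would have to be renumbered each time.\<close>

lemma interval_chain_of_separated:
  assumes "separated 1 P"
  shows "\<exists>a b. interval_chain (card P) a b \<and> (\<lambda>k. (a k, b k)) ` {1..card P} = P"
  using assms
proof (induction "card P" arbitrary: P)
  case 0
  then have "P = {}" by (simp add: separated_def)
  then show ?case by (auto simp: interval_chain_def intro!: exI[of _ "\<lambda>_. 1"])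
next
  case (Suc n)
  have fin: "finite P" and "P \<noteq> {}" using Suc.hyps(2) by (auto intro: card_ge_0_finite)
  then obtain p where p: "p \<in> P" "\<And>q. q \<in> P \<Longrightarrow> fst q \<le> fst p"
    using obtains_MAX[of P fst] by (metis Max_ge finite_imageI imageI)
  define Q where "Q = P - {p}"
  have cQ: "card Q = n" using Suc.hyps(2) p(1) fin by (simp add: Q_def)
  have "separated 1 Q" using Suc.prems by (rule separated_subset) (auto simp: Q_def)
  then obtain a b where ab: "interval_chain n a b" "(\<lambda>k. (a k, b k)) ` {1..n} = Q"
    using Suc.hyps(1)[of Q] cQ by auto
  have last: "snd q \<le> fst p" if "q \<in> Q" for q
  proof -
    have "q \<in> P" "q \<noteq> p" using that by (auto simp: Q_def)
    then have "snd q \<le> fst p \<or> snd p \<le> fst q" using Suc.prems p(1) by (auto simp: separated_def)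
    moreover have "fst p < snd p" using Suc.prems p(1) by (auto simp: separated_def)
    ultimately show ?thesis using p(2)[OF \<open>q \<in> P\<close>] by linarith
  qed
  define a' where "a' = a(Suc n := fst p)"
  define b' where "b' = b(Suc n := snd p)"
  have "interval_chain (Suc n) a' b'"
    unfolding interval_chain_def
  proof (intro conjI ballI)
    show "1 \<le> a' 1" using Suc.prems p(1) ab(1) by (auto simp: a'_def interval_chain_def separated_def)
  next
    fix k assume "k \<in> {1..Suc n}"
    then show "a' k < b' k"
      using interval_chain_less[OF ab(1), of k] Suc.prems p(1)
      by (cases "k = Suc n") (auto simp: a'_def b'_def separated_def)
  next
    fix k assume k: "k \<in> {1..<Suc n}"
    then have "(a k, b k) \<in> Q" using ab(2) by auto
    then show "b' k \<le> a' (Suc k)"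
      using k last[of "(a k, b k)"] ab(1) by (auto simp: a'_def b'_def interval_chain_def)
  qed
  moreover have "(\<lambda>k. (a' k, b' k)) ` {1..Suc n} = P"
  proof -
    have "{1..Suc n} = insert (Suc n) {1..n}" by auto
    moreover have "(\<lambda>k. (a' k, b' k)) ` {1..n} = (\<lambda>k. (a k, b k)) ` {1..n}"
      by (rule image_cong) (auto simp: a'_def b'_def)
    ultimately show ?thesis using ab(2) p(1) by (auto simp: Q_def a'_def b'_def)
  qed
  ultimately show ?case using Suc.hyps(2) by metis
qed

text \<open>Common shape of \<open>Phi_plus_inf\<close> and \<open>Phi_minus_inf\<close>;
  \<open>R\<close> is the relation required between the left and the right endpoint.\<close>

definition chain_sup :: "(real \<Rightarrow> real \<Rightarrow> bool) \<Rightarrow> enat" where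
  "chain_sup R = Sup {enat n | n. \<exists>a b. interval_chain n a b \<and> (\<forall>k\<in>{1..n}. R (a k) (b k))}"

lemma card_le_chain_sup:
  assumes "separated 1 P" "\<And>p. p \<in> P \<Longrightarrow> R (fst p) (snd p)"
  shows "enat (card P) \<le> chain_sup R"
proof -
  obtain a b where ab: "interval_chain (card P) a b" "(\<lambda>k. (a k, b k)) ` {1..card P} = P"
    using interval_chain_of_separated[OF assms(1)] by auto
  have "R (a k) (b k)" if "k \<in> {1..card P}" for k
  proof -
    have "(a k, b k) \<in> P" using ab(2) that by blast
    from assms(2)[OF this] show ?thesis by simp
  qed
  then show ?thesis unfolding chain_sup_def using ab(1) by (intro Sup_upper) blast
qed

lemma chain_sup_le:
  assumes "\<And>P. separated 1 P \<Longrightarrow> (\<And>p. p \<in> P \<Longrightarrow> R (fst p) (snd p)) \<Longrightarrow> real (card P) \<le> M"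
  shows "ereal_of_enat (chain_sup R) \<le> ereal M"
proof -
  have M: "0 \<le> M" using assms[of "{}"] by (simp add: separated_def)
  have "chain_sup R \<le> enat (nat \<lfloor>M\<rfloor>)"
    unfolding chain_sup_def
  proof (rule Sup_least, clarify)
    fix n a b assume "interval_chain n a b" "\<forall>k\<in>{1..n}. R (a k) (b k)"
    then have "real (card ((\<lambda>k. (a k, b k)) ` {1..n})) \<le> M"
      by (intro assms separated_of_interval_chain) auto
    then have "real n \<le> M"
      using separated_of_interval_chain(2)[of n a b] \<open>interval_chain n a b\<close> by simp
    then show "enat n \<le> enat (nat \<lfloor>M\<rfloor>)" by (simp add: le_nat_floor)
  qed
  then have "ereal_of_enat (chain_sup R) \<le> ereal_of_enat (enat (nat \<lfloor>M\<rfloor>))"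
    by (simp only: ereal_of_enat_le_iff)
  also have "\<dots> \<le> ereal M" using M by (simp add: of_nat_nat)
  finally show ?thesis .
qed

lemma Phi_plus_inf_chain_sup:
  "Phi_plus_inf F x C = chain_sup (\<lambda>s t. C * dilate F s x \<le> dilate F t x)"
  by (simp add: Phi_plus_inf_def chain_sup_def)

lemma Phi_minus_inf_chain_sup:
  "Phi_minus_inf F x C = chain_sup (\<lambda>s t. C * dilate F t x \<le> dilate F s x)"
  by (simp add: Phi_minus_inf_def chain_sup_def)

text \<open>Both directions in one predicate, so that a single count controls the sum of the two
  suprema.\<close>

definition oscillates :: "(real \<Rightarrow> real) \<Rightarrow> real \<Rightarrow> real \<Rightarrow> real \<times> real \<Rightarrow> bool" where
  "oscillates F x C p \<longleftrightarrow> C * dilate F (fst p) x \<le> dilate F (snd p) x \<or>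
     C * dilate F (snd p) x \<le> dilate F (fst p) x"

text \<open>The threshold \<open>c\<close> is kept variable because the heights attached to a
  sequence can be smaller than 1.\<close>

definition bounded_oscillation :: "(real \<Rightarrow> real) \<Rightarrow> real \<Rightarrow> real \<Rightarrow> real \<Rightarrow> real \<Rightarrow> bool" where
  "bounded_oscillation F c C K r \<longleftrightarrow>
     (\<forall>x P. 0 < x \<and> x \<le> 1 \<and> separated c P \<and> (\<forall>p\<in>P. oscillates F x C p) \<longrightarrow>
        real (card P) \<le> K * x powr (- r))"

text \<open>A family splits into rises and falls, each counted by one of the two suprema. In the
  other direction each supremum obeys the common bound, whence the factor 2.\<close>

lemma elastic_at_infinity_iff:
  "elastic_at_infinity F \<longleftrightarrow> (\<exists>C K r. C > 1 \<and> K > 1 \<and> r > 0 \<and> bounded_oscillation F 1 C K r)"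
proof
  assume "elastic_at_infinity F"
  then obtain C K r where CKr: "C > 1" "K > 1" "r > 0"
    and le: "\<And>x. 0 < x \<Longrightarrow> x \<le> 1 \<Longrightarrow>
      ereal_of_enat (Phi_plus_inf F x C + Phi_minus_inf F x C) \<le> ereal (K * x powr (- r))"
    unfolding elastic_at_infinity_def by blast
  have "bounded_oscillation F 1 C K r"
    unfolding bounded_oscillation_def
  proof clarify
    fix x :: real and P assume x: "0 < x" "x \<le> 1" and P: "separated 1 P" "\<forall>p\<in>P. oscillates F x C p"
    define Q where "Q = {p\<in>P. C * dilate F (fst p) x \<le> dilate F (snd p) x}"
    define R where "R = {p\<in>P. C * dilate F (snd p) x \<le> dilate F (fst p) x}"
    have "enat (card Q) \<le> Phi_plus_inf F x C" unfolding Phi_plus_inf_chain_sup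
      by (rule card_le_chain_sup[OF separated_subset[OF P(1)]]) (auto simp: Q_def)
    moreover have "enat (card R) \<le> Phi_minus_inf F x C" unfolding Phi_minus_inf_chain_sup
      by (rule card_le_chain_sup[OF separated_subset[OF P(1)]]) (auto simp: R_def)
    ultimately have "enat (card Q + card R) \<le> Phi_plus_inf F x C + Phi_minus_inf F x C"
      by (metis add_mono plus_enat_simps(1))
    then have "ereal_of_enat (enat (card Q + card R)) \<le> ereal (K * x powr (- r))"
      using le[OF x] by (metis ereal_of_enat_le_iff order_trans)
    then have "real (card Q + card R) \<le> K * x powr (- r)" by simp
    moreover have "card P \<le> card Q + card R"
    proof -
      have "P = Q \<union> R" using P(2) by (auto simp: Q_def R_def oscillates_def)
      then show ?thesis by (metis card_Un_le)
    qed
    ultimately show "real (card P) \<le> K * x powr (- r)" by linarith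
  qed
  with CKr show "\<exists>C K r. C > 1 \<and> K > 1 \<and> r > 0 \<and> bounded_oscillation F 1 C K r" by blast
next
  assume "\<exists>C K r. C > 1 \<and> K > 1 \<and> r > 0 \<and> bounded_oscillation F 1 C K r"
  then obtain C K r where CKr: "C > 1" "K > 1" "r > 0" and b: "bounded_oscillation F 1 C K r"
    by blast
  have "ereal_of_enat (Phi_plus_inf F x C + Phi_minus_inf F x C) \<le> ereal (2 * K * x powr (- r))"
    if x: "0 < x" "x \<le> 1" for x
  proof -
    have "ereal_of_enat (Phi_plus_inf F x C) \<le> ereal (K * x powr (- r))"
      unfolding Phi_plus_inf_chain_sup
      using b x by (intro chain_sup_le) (auto simp: bounded_oscillation_def oscillates_def)
    moreover have "ereal_of_enat (Phi_minus_inf F x C) \<le> ereal (K * x powr (- r))"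
      unfolding Phi_minus_inf_chain_sup
      using b x by (intro chain_sup_le) (auto simp: bounded_oscillation_def oscillates_def)
    ultimately have "ereal_of_enat (Phi_plus_inf F x C) + ereal_of_enat (Phi_minus_inf F x C)
        \<le> ereal (K * x powr (- r)) + ereal (K * x powr (- r))" by (rule add_mono)
    then show ?thesis by (simp add: ereal_of_enat_add mult.assoc)
  qed
  then show "elastic_at_infinity F"
    unfolding elastic_at_infinity_def using CKr by (intro exI[of _ C] exI[of _ "2 * K"] exI[of _ r]) auto
qed

section \<open>Dilations of an Orlicz function\<close>

locale orlicz_delta2 =
  fixes F :: "real \<Rightarrow> real" and D :: real
  assumes orlicz: "orlicz_function F"
    and doubling: "\<And>x. 0 \<le> x \<Longrightarrow> F (2 * x) \<le> D * F x"
begin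

lemma F_zero: "F 0 = 0"
  using orlicz by (simp add: orlicz_function_def)

lemma F_less: "0 \<le> x \<Longrightarrow> x < y \<Longrightarrow> F x < F y"
  using orlicz unfolding orlicz_function_def by (auto intro: strict_mono_onD)

lemma F_mono: "0 \<le> x \<Longrightarrow> x \<le> y \<Longrightarrow> F x \<le> F y"
  using F_less[of x y] by (cases "x = y") auto

lemma F_pos: "0 < x \<Longrightarrow> 0 < F x"
  using F_less[of 0 x] F_zero by simp

lemma F_nonneg: "0 \<le> x \<Longrightarrow> 0 \<le> F x"
  using F_mono[of 0 x] F_zero by simp

lemma F_le_iff: "0 \<le> x \<Longrightarrow> 0 \<le> y \<Longrightarrow> F x \<le> F y \<longleftrightarrow> x \<le> y"
  using F_mono F_less by (metis not_less)

lemma F_mult_le: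
  assumes "0 \<le> s" "s \<le> 1" "0 \<le> x" shows "F (s * x) \<le> s * F x"
proof -
  have "convex_on {0..} F" using orlicz by (simp add: orlicz_function_def)
  from convex_onD[OF this, of s 0 x] assms show ?thesis by (simp add: F_zero)
qed

lemma F_mult_ge:
  assumes "1 \<le> s" "0 \<le> x" shows "s * F x \<le> F (s * x)"
  using F_mult_le[of "1 / s" "s * x"] assms by (simp add: field_simps)

lemma F_continuous: "continuous_on {0..} F"
  using orlicz by (simp add: orlicz_function_def)

lemma D_ge_2: "2 \<le> D"
proof -
  have "2 * F 1 \<le> D * F 1" using F_mult_ge[of 2 1] doubling[of 1] by simp
  then show ?thesis using F_pos[of 1] by simp
qed

lemma F_pow2_le: "0 \<le> x \<Longrightarrow> F (2 ^ n * x) \<le> D ^ n * F x"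
proof (induction n)
  case (Suc n)
  have "F (2 ^ Suc n * x) \<le> D * F (2 ^ n * x)"
    using doubling[of "2 ^ n * x"] Suc.prems by (simp add: mult.assoc)
  also have "\<dots> \<le> D * (D ^ n * F x)" using Suc D_ge_2 by (intro mult_left_mono) auto
  finally show ?case by simp
qed simp

lemma F_surj:
  assumes "0 \<le> v" shows "\<exists>t\<ge>0. F t = v"
proof -
  \<comment> \<open>By convexity F(s) is at least s F(1) for s \<ge> 1, so \<open>F\<close> has
    reached \<open>v\<close> at this point.\<close>
  define s where "s = max 1 (v / F 1)"
  have "v \<le> s * F 1"
    using F_pos[of 1] by (simp add: s_def max_def field_simps)
  also have "\<dots> \<le> F (s * 1)" by (rule F_mult_ge) (auto simp: s_def)
  finally have "v \<le> F s" by simp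
  moreover have "continuous_on {0..s} F" by (rule continuous_on_subset[OF F_continuous]) auto
  moreover have "0 \<le> s" by (simp add: s_def)
  ultimately show ?thesis
    using IVT'[of F 0 v s] assms F_zero by auto
qed

abbreviation \<phi> :: "real \<Rightarrow> real \<Rightarrow> real" where "\<phi> \<equiv> dilate F"

lemma \<phi>_pos: "0 < t \<Longrightarrow> 0 < s \<Longrightarrow> 0 < \<phi> t s"
  by (simp add: dilate_def F_pos)

lemma \<phi>_le: "0 < t \<Longrightarrow> 0 \<le> s \<Longrightarrow> s \<le> 1 \<Longrightarrow> \<phi> t s \<le> s"
  using F_mult_le[of s t] F_pos[of t] by (simp add: dilate_def mult.commute pos_divide_le_eq)

lemma \<phi>_mono: "0 < t \<Longrightarrow> 0 \<le> s \<Longrightarrow> s \<le> s' \<Longrightarrow> \<phi> t s \<le> \<phi> t s'"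
  using F_pos[of t] by (simp add: dilate_def F_mono divide_right_mono)

lemma \<phi>_mult: "0 < t \<Longrightarrow> F t * \<phi> t s = F (t * s)"
  using F_pos[of t] by (simp add: dilate_def)

text \<open>The cocycle identity; iterated, it factors \<open>\<phi> t (x ^ m)\<close>.\<close>

lemma \<phi>_split: "0 < t \<Longrightarrow> 0 < x \<Longrightarrow> \<phi> t (x * y) = \<phi> t x * \<phi> (t * x) y"
  using F_pos[of "t * x"] by (simp add: dilate_def mult.assoc)

lemma \<phi>_pow2_le: "0 < t \<Longrightarrow> 0 \<le> s \<Longrightarrow> \<phi> t (2 ^ n * s) \<le> D ^ n * \<phi> t s"
  using F_pow2_le[of "t * s" n] F_pos[of t]
  by (simp add: dilate_def divide_right_mono mult.left_commute)

text \<open>Between \<open>t\<close> and \<open>2 ^ n * t\<close> the numerator and the denominator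
  of \<open>\<phi>\<close> each grow by a factor at most \<open>D ^ n\<close>. Hence only the dyadic
  size of the parameter matters.\<close>

lemma \<phi>_comparable:
  assumes "0 < t" "t \<le> u" "u \<le> 2 ^ n * t" "0 \<le> s"
  shows "\<phi> u s \<le> D ^ n * \<phi> t s" "\<phi> t s \<le> D ^ n * \<phi> u s"
proof -
  have pos: "0 < F t" "0 < F u" "0 < D ^ n" "0 \<le> F (t * s)" "0 \<le> F (u * s)"
    using assms D_ge_2 by (auto simp: F_pos F_nonneg)
  have "F (u * s) \<le> F (2 ^ n * (t * s))"
    using assms by (intro F_mono) (auto simp: mult_right_mono simp flip: mult.assoc)
  also have "\<dots> \<le> D ^ n * F (t * s)" using assms by (intro F_pow2_le) auto
  finally have "F (u * s) \<le> D ^ n * F (t * s)" .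
  moreover have "F t \<le> F u" using assms by (intro F_mono) auto
  ultimately have "F (u * s) / F u \<le> D ^ n * F (t * s) / F t"
    using pos by (intro frac_le) auto
  then show "\<phi> u s \<le> D ^ n * \<phi> t s" by (simp add: dilate_def)
  have "F u \<le> F (2 ^ n * t)" using assms by (intro F_mono) auto
  also have "\<dots> \<le> D ^ n * F t" using assms by (intro F_pow2_le) auto
  finally have "F u \<le> D ^ n * F t" .
  moreover have "F (t * s) \<le> F (u * s)" using assms by (intro F_mono) (auto simp: mult_right_mono)
  ultimately have "F (t * s) * F u \<le> F (u * s) * (D ^ n * F t)"
    using pos by (intro mult_mono) auto
  then show "\<phi> t s \<le> D ^ n * \<phi> u s" using pos by (simp add: dilate_def field_simps)
qed

text \<open>About log_2(1/x) doublings carry x past 1, each at the cost of a factor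
  \<open>D\<close>; rounding their number up costs one more \<open>D\<close>. This is the source of
  the exponent \<open>log 2 D\<close> in the converse.\<close>

lemma \<phi>_lower_bound:
  assumes "0 < t" "0 < x" "x \<le> 1"
  shows "x powr log 2 D / D \<le> \<phi> t x"
proof -
  define n where "n = nat \<lceil>log 2 (1 / x)\<rceil>"
  have nn: "0 \<le> log 2 (1 / x)" using assms by simp
  have "log 2 (1 / x) \<le> n" unfolding n_def using nn by linarith
  then have "1 / x \<le> 2 ^ n" using assms by (simp add: log_le_iff powr_realpow)
  then have "1 \<le> 2 ^ n * x" using assms by (simp add: field_simps)
  then have "\<phi> t 1 \<le> \<phi> t (2 ^ n * x)" using assms by (intro \<phi>_mono) auto
  also have "\<dots> \<le> D ^ n * \<phi> t x" using assms by (intro \<phi>_pow2_le) auto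
  finally have "1 \<le> D ^ n * \<phi> t x" using F_pos[of t] assms by (simp add: dilate_def)
  also have "\<dots> \<le> (D * x powr (- log 2 D)) * \<phi> t x"
  proof (rule mult_right_mono)
    have "real n \<le> 1 + log 2 (1 / x)" unfolding n_def using nn by linarith
    then have "D powr n \<le> D powr (1 + log 2 (1 / x))" using D_ge_2 by (intro powr_mono) auto
    also have "\<dots> = D * D powr (log 2 (1 / x))" using D_ge_2 by (simp add: powr_add)
    also have "D powr (log 2 (1 / x)) = x powr (- log 2 D)"
      using D_ge_2 assms by (simp add: powr_def log_def ln_div)
    finally show "D ^ n \<le> D * x powr (- log 2 D)" using D_ge_2 by (simp add: powr_realpow)
  qed (use \<phi>_pos[of t x] assms in auto)
  finally show ?thesis using D_ge_2 assms by (simp add: powr_minus field_simps)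
qed

section \<open>Powers of the argument and lowering the exponent to 1/2\<close>

lemma \<phi>_power: "0 < t \<Longrightarrow> 0 < x \<Longrightarrow> \<phi> t (x ^ m) = (\<Prod>i<m. \<phi> (t * x ^ i) x)"
proof (induction m)
  case 0
  then show ?case using F_pos[of t] by (simp add: dilate_def)
next
  case (Suc m)
  then show ?case using \<phi>_split[of t "x ^ m" x] by (simp add: mult.commute)
qed

text \<open>If each of the \<open>m\<close> factors changed by at most \<open>C\<close>, the product
  would change by at most \<open>C ^ m\<close>.\<close>

lemma oscillates_power:
  assumes "0 < fst p" "0 < snd p" "0 < x" "0 < C" "C ^ m < C'" "oscillates F (x ^ m) C' p"
  shows "\<exists>i<m. oscillates F x C (fst p * x ^ i, snd p * x ^ i)"
proof (rule ccontr)
  assume "\<not> ?thesis"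
  then have lt: "\<phi> (snd p * x ^ i) x \<le> C * \<phi> (fst p * x ^ i) x"
    "\<phi> (fst p * x ^ i) x \<le> C * \<phi> (snd p * x ^ i) x" if "i < m" for i
    using that by (fastforce simp: oscillates_def)+
  have le: "\<phi> t (x ^ m) \<le> C ^ m * \<phi> u (x ^ m)"
    if "0 < t" "0 < u" "\<And>i. i < m \<Longrightarrow> \<phi> (t * x ^ i) x \<le> C * \<phi> (u * x ^ i) x" for t u
  proof -
    have "\<phi> t (x ^ m) = (\<Prod>i<m. \<phi> (t * x ^ i) x)" using \<phi>_power that assms by simp
    also have "\<dots> \<le> (\<Prod>i<m. C * \<phi> (u * x ^ i) x)"
      using that assms by (intro prod_mono) (auto intro!: less_imp_le \<phi>_pos)
    also have "\<dots> = C ^ m * \<phi> u (x ^ m)" using \<phi>_power that assms by (simp add: prod.distrib)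
    finally show ?thesis .
  qed
  have pos: "0 < \<phi> (fst p) (x ^ m)" "0 < \<phi> (snd p) (x ^ m)" using assms by (auto intro!: \<phi>_pos)
  then have "C ^ m * \<phi> (fst p) (x ^ m) < C' * \<phi> (fst p) (x ^ m)"
    "C ^ m * \<phi> (snd p) (x ^ m) < C' * \<phi> (snd p) (x ^ m)" using assms by auto
  then show False using le[OF assms(1,2) lt(2)] le[OF assms(2,1) lt(1)] assms(6)
    by (auto simp: oscillates_def)
qed

text \<open>Contrapositive of \<open>\<phi>_comparable\<close> with exponent 1: within a factor 2 of
  the parameter the change is at most \<open>D\<close>.\<close>

lemma oscillates_doubles:
  assumes "0 < fst p" "fst p < snd p" "0 < x" "D < C" "oscillates F x C p"
  shows "2 * fst p < snd p"
proof (rule ccontr)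
  assume "\<not> ?thesis"
  then have "\<phi> (snd p) x \<le> D * \<phi> (fst p) x" "\<phi> (fst p) x \<le> D * \<phi> (snd p) x"
    using \<phi>_comparable[of "fst p" "snd p" 1 x] assms by auto
  moreover have "D * \<phi> (fst p) x < C * \<phi> (fst p) x" "D * \<phi> (snd p) x < C * \<phi> (snd p) x"
    using assms \<phi>_pos by auto
  ultimately show False using assms(5) by (auto simp: oscillates_def)
qed

end

text \<open>Doubling makes the integer parts of the binary logarithms of the left endpoints
  distinct, and they lie between those of \<open>c\<close> and \<open>M\<close>.\<close>

lemma card_doubling_le:
  assumes P: "separated c P" and c: "0 < c"
    and dbl: "\<And>p. p \<in> P \<Longrightarrow> 2 * fst p < snd p"
    and le: "\<And>p. p \<in> P \<Longrightarrow> fst p \<le> M" and M: "c \<le> M"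
  shows "real (card P) \<le> log 2 (M / c) + 2"
proof -
  define h :: "real \<times> real \<Rightarrow> int" where "h p = \<lfloor>log 2 (fst p)\<rfloor>" for p
  have cle: "c \<le> fst p" if "p \<in> P" for p using P that by (simp add: separated_def)
  have ne: "h p < h q" if pq: "p \<in> P" "q \<in> P" "snd p \<le> fst q" for p q
  proof -
    have "2 * fst p < fst q" using dbl[OF pq(1)] pq(3) by linarith
    then have "log 2 (2 * fst p) \<le> log 2 (fst q)"
      using cle[OF pq(1)] c by (intro log_mono) auto
    moreover have "log 2 (2 * fst p) = log 2 (fst p) + 1"
      using cle[OF pq(1)] c by (simp add: log_mult)
    ultimately show ?thesis unfolding h_def by linarith
  qed
  have "inj_on h P"
  proof (rule inj_onI, rule ccontr)
    fix p q assume pq: "p \<in> P" "q \<in> P" "h p = h q" "p \<noteq> q"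
    then have "snd p \<le> fst q \<or> snd q \<le> fst p" using P by (auto simp: separated_def)
    then show False using ne[of p q] ne[of q p] pq by auto
  qed
  moreover have "h ` P \<subseteq> {\<lfloor>log 2 c\<rfloor>..\<lfloor>log 2 M\<rfloor>}"
    using cle c le by (fastforce simp: h_def intro!: floor_mono log_mono)
  ultimately have "card P \<le> card {\<lfloor>log 2 c\<rfloor>..\<lfloor>log 2 M\<rfloor>}" by (metis card_inj_on_le finite_atLeastAtMost_int)
  also have "\<dots> = nat (\<lfloor>log 2 M\<rfloor> - \<lfloor>log 2 c\<rfloor> + 1)" by simp
  finally have "real (card P) \<le> real (nat (\<lfloor>log 2 M\<rfloor> - \<lfloor>log 2 c\<rfloor> + 1))" by simp
  also have "\<dots> \<le> log 2 M - log 2 c + 2"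
  proof -
    have "log 2 c \<le> log 2 M" using c M by simp
    then have "\<lfloor>log 2 c\<rfloor> \<le> \<lfloor>log 2 M\<rfloor>" by (rule floor_mono)
    then show ?thesis by linarith
  qed
  finally show ?thesis using c M by (simp add: log_divide)
qed

context orlicz_delta2
begin

text \<open>The exponent 1/2 is a convenient choice below 1. With u = x^m and m \<ge> 2 r, x^(-r) is
  at most u^(-1/2). Intervals starting beyond 1/u stay inside [1, infinity) when scaled by x^i with
  i < m; the others more than double, so their number is logarithmic in 1/u.\<close>

lemma bounded_oscillation_sqrt:
  assumes b: "bounded_oscillation F 1 C K r" and C: "C > 1" and K: "K > 0" and r: "r > 0"
    and c: "0 < c" "c \<le> 1"
  shows "\<exists>C' K'. C' > 1 \<and> K' > 0 \<and> bounded_oscillation F c C' K' (1 / 2)"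
proof -
  define m where "m = nat \<lceil>2 * r\<rceil>"
  have m: "2 * r \<le> m" "0 < m" using r unfolding m_def by linarith+
  \<comment> \<open>Above \<open>C ^ m\<close> for \<open>oscillates_power\<close> and above
    \<open>D\<close> for \<open>oscillates_doubles\<close>.\<close>
  define C' where "C' = C ^ m + D + 1"
  have C': "C ^ m < C'" "D < C'" "1 < C'"
    using D_ge_2 C one_le_power[of C m] by (auto simp: C'_def add.commute intro: add_strict_increasing)
  \<comment> \<open>\<open>m * K\<close> counts the \<open>m\<close> scaled families
    \<open>Q i\<close>; the rest counts \<open>R\<close>, with 4 from comparing log_2(1/u) to
    u^(-1/2).\<close>
  define K' where "K' = m * K + (4 + log 2 (1 / c) + 2)"
  have logc: "0 \<le> log 2 (1 / c)" using c by simp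
  have K': "K' > 0" using logc K by (simp add: K'_def add_nonneg_pos)
  have "real (card P) \<le> K' * u powr (- (1 / 2))"
    if u: "0 < u" "u \<le> 1" and P: "separated c P" "\<forall>p\<in>P. oscillates F u C' p" for u P
  proof -
    define x where "x = root m u"
    have x: "0 < x" "x \<le> 1" "x ^ m = u" using u m by (auto simp: x_def)
    have x_pow: "u \<le> x ^ i" if "i < m" for i
      using power_decreasing[of i m x] x that by auto
    have finP: "finite P" using P by (simp add: separated_def)
    have P_pos: "0 < fst p" "fst p < snd p" if "p \<in> P" for p
      using P(1) c that by (auto simp: separated_def)
    define Q where "Q i = {p \<in> P. 1 / u < fst p \<and> oscillates F x C (fst p * x ^ i, snd p * x ^ i)}" for i
    define R where "R = {p \<in> P. fst p \<le> 1 / u}"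
    have Q: "real (card (Q i)) \<le> K * u powr (- (1 / 2))" if i: "i < m" for i
    proof -
      let ?g = "\<lambda>p. (fst p * x ^ i, snd p * x ^ i)"
      have inj: "inj_on ?g (Q i)" using x by (auto intro!: inj_onI simp: prod_eq_iff)
      have "separated 1 (?g ` Q i)"
        unfolding separated_def
      proof (intro conjI ballI impI)
        show "finite (?g ` Q i)" using finP by (auto simp: Q_def)
      next
        fix p assume "p \<in> ?g ` Q i"
        then obtain q where q: "p = ?g q" "q \<in> Q i" by auto
        then have "1 / u * u \<le> fst q * x ^ i"
          using x_pow[OF i] u P_pos(1) by (intro mult_mono) (auto simp: Q_def less_imp_le)
        then show "1 \<le> fst p" using q u by simp
        show "fst p < snd p" using q P_pos x by (auto simp: Q_def)
      next
        fix p p' assume "p \<in> ?g ` Q i" "p' \<in> ?g ` Q i" "p \<noteq> p'"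
        then obtain q q' where "p = ?g q" "q \<in> Q i" "p' = ?g q'" "q' \<in> Q i" "q \<noteq> q'" by auto
        then show "snd p \<le> fst p' \<or> snd p' \<le> fst p"
          using P(1) x by (auto simp: Q_def separated_def)
      qed
      moreover have "\<forall>p\<in>?g ` Q i. oscillates F x C p" by (auto simp: Q_def)
      ultimately have "real (card (?g ` Q i)) \<le> K * x powr (- r)"
        using b x unfolding bounded_oscillation_def by blast
      moreover have "x powr (- r) \<le> u powr (- (1 / 2))"
      proof -
        have "x powr (- r) \<le> x powr (- (m / 2))"
          using x m by (intro powr_mono') auto
        also have "\<dots> = (x powr m) powr (- (1 / 2))" by (simp add: powr_powr)
        also have "\<dots> = u powr (- (1 / 2))" using x by (simp add: powr_realpow)
        finally show ?thesis .
      qed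
      ultimately show ?thesis using K by (auto simp: card_image[OF inj] intro: order_trans)
    qed
    have R: "real (card R) \<le> (4 + log 2 (1 / c) + 2) * u powr (- (1 / 2))"
    proof -
      have "real (card R) \<le> log 2 (1 / u / c) + 2"
      proof (rule card_doubling_le)
        show "separated c R" using P(1) by (rule separated_subset) (auto simp: R_def)
        show "2 * fst p < snd p" if "p \<in> R" for p
          using that P_pos P(2) oscillates_doubles[of p u C'] u C' by (auto simp: R_def)
        have "1 \<le> 1 / u" using u by simp
        then show "c \<le> 1 / u" using c by linarith
      qed (use c in \<open>auto simp: R_def\<close>)
      also have "log 2 (1 / u / c) = log 2 (1 / u) + log 2 (1 / c)"
        using u c by (simp add: log_divide log_mult)
      \<comment> \<open>This is ln y \<le> y for y = u^(-1/2), together with ln 2 \<ge> 1/2.\<close>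
      also have "log 2 (1 / u) \<le> 4 * u powr (- (1 / 2))"
      proof -
        define y where "y = u powr (- (1 / 2))"
        have y: "y > 0" "ln y = ln (1 / u) / 2" using u by (auto simp: y_def ln_powr ln_div)
        have "ln y \<le> y" using ln_le_minus_one[of y] y by simp
        then have "ln (1 / u) \<le> 2 * y" using y by simp
        moreover have "1 / 2 \<le> ln (2::real)" using ln2_ge_two_thirds by simp
        ultimately have "ln (1 / u) / ln 2 \<le> 2 * y / (1 / 2)" using y by (intro frac_le) auto
        then show ?thesis by (simp add: log_def y_def)
      qed
      finally have "real (card R) \<le> 4 * u powr (- (1 / 2)) + (log 2 (1 / c) + 2)" by simp
      moreover have "1 \<le> u powr (- (1 / 2))" using u by (simp add: powr_minus field_simps powr_le1)
      then have "(log 2 (1 / c) + 2) * 1 \<le> (log 2 (1 / c) + 2) * u powr (- (1 / 2))"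
        using logc by (intro mult_left_mono) auto
      ultimately show ?thesis by (simp add: algebra_simps)
    qed
    have "P \<subseteq> R \<union> (\<Union>i<m. Q i)"
    proof
      fix p assume p: "p \<in> P"
      have "oscillates F (x ^ m) C' p" using P(2) p x by simp
      then have "\<exists>i<m. oscillates F x C (fst p * x ^ i, snd p * x ^ i)"
        using P_pos[OF p] C C' x by (intro oscillates_power[of p x C m C']) auto
      then show "p \<in> R \<union> (\<Union>i<m. Q i)" using p by (auto simp: R_def Q_def)
    qed
    then have "card P \<le> card (R \<union> (\<Union>i<m. Q i))"
      using finP by (intro card_mono) (auto simp: R_def Q_def)
    also have "\<dots> \<le> card R + card (\<Union>i<m. Q i)" by (rule card_Un_le)
    also have "card (\<Union>i<m. Q i) \<le> (\<Sum>i<m. card (Q i))" by (rule card_UN_le) auto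
    finally have "real (card P) \<le> real (card R) + (\<Sum>i<m. real (card (Q i)))"
      by (simp flip: of_nat_sum of_nat_add)
    also have "(\<Sum>i<m. real (card (Q i))) \<le> m * (K * u powr (- (1 / 2)))"
      using sum_bounded_above[of "{..<m}" "\<lambda>i. real (card (Q i))" "K * u powr (- (1 / 2))"] Q by simp
    finally show ?thesis using R by (simp add: K'_def algebra_simps)
  qed
  then show ?thesis using C' K' unfolding bounded_oscillation_def by blast
qed

end

section \<open>Dyadic weights and dyadic intervals\<close>

lemma sum_powi_le:
  assumes "S \<subseteq> {..B}" "finite S"
  shows "(\<Sum>k\<in>S. 2 powi k) \<le> 2 * (2 powi B :: real)"
proof -
  have inj: "inj_on (\<lambda>k. nat (B - k)) S"   proof (rule inj_onI)
    fix k l assume *: "k \<in> S" "l \<in> S" "nat (B - k) = nat (B - l)"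
    then have "k \<le> B" "l \<le> B" using assms by auto
    then show "k = l" using *(3) by simp
  qed
  have "(\<Sum>k\<in>S. 2 powi k) = (\<Sum>k\<in>S. 2 powi B * (1 / 2) ^ nat (B - k) :: real)"
  proof (rule sum.cong[OF refl])
    fix k assume "k \<in> S"
    then have "k \<le> B" using assms by auto
    then have "(2::real) powi B = 2 powi k * 2 powi (B - k)"
      by (simp flip: power_int_add)
    also have "2 powi (B - k) = (2::real) ^ nat (B - k)"
      using \<open>k \<le> B\<close> by (simp add: power_int_def)
    finally show "(2::real) powi k = 2 powi B * (1 / 2) ^ nat (B - k)"
      by (simp add: power_one_over)
  qed
  also have "\<dots> = 2 powi B * (\<Sum>j\<in>(\<lambda>k. nat (B - k)) ` S. (1 / 2) ^ j)"
    by (simp add: sum.reindex[OF inj] sum_distrib_left)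
  also have "(\<Sum>j\<in>(\<lambda>k. nat (B - k)) ` S. (1 / 2) ^ j) \<le> (\<Sum>j. (1 / 2 :: real) ^ j)"
    using assms by (intro sum_le_suminf summable_geometric) auto
  also have "\<dots> = 2" by (simp add: suminf_geometric)
  finally show ?thesis by simp
qed

lemma powi_interval_unique:
  fixes t :: real and k l :: int
  assumes "2 powi k \<le> t" "t < 2 powi (k + 1)" "2 powi l \<le> t" "t < 2 powi (l + 1)"
  shows "k = l"
proof -
  have "False" if "t < 2 powi (i + 1)" "2 powi j \<le> t" "i < j" for i j :: int
    using power_int_increasing[of "i + 1" j "2::real"] that by auto
  then show ?thesis using assms by (meson linorder_neqE_linordered_idom)
qed

lemma step_function_eq_sum:
  assumes "finite S" "S \<subseteq> {..<0}" "supp x \<subseteq> S"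
  shows "step_function x t = (\<Sum>k\<in>S. x k * indicator {2 powi k ..< 2 powi (k + 1)} t)"
proof -
  have "step_function x t = (\<Sum>\<^sub>\<infinity>k\<in>S. x k * indicator {2 powi k ..< 2 powi (k + 1)} t)"
    unfolding step_function_def using assms
    by (intro infsum_cong_neutral) (auto simp: support_on_def)
  then show ?thesis using assms by simp
qed

lemma dyadic_interval_subset:
  assumes "k < (0::int)"
  shows "{2 powi k ..< 2 powi (k + 1)} \<subseteq> {0..1::real}"
proof
  fix t :: real assume t: "t \<in> {2 powi k ..< 2 powi (k + 1)}"
  have "0 \<le> t" by (rule order_trans[of _ "2 powi k"]) (use t in auto)
  moreover have "(2::real) powi (k + 1) \<le> 1"
    using power_int_increasing[of "k + 1" 0 "2::real"] assms by simp
  ultimately show "t \<in> {0..1}" using t by auto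
qed

lemma emeasure_dyadic_interval:
  assumes "k < (0::int)"
  shows "emeasure (lebesgue_on {0..1}) {2 powi k ..< 2 powi (k + 1) :: real} = ennreal (2 powi k)"
proof -
  have "emeasure (lebesgue_on {0..1}) {2 powi k ..< 2 powi (k + 1) :: real}
      = emeasure lebesgue {2 powi k ..< 2 powi (k + 1) :: real}"
    using dyadic_interval_subset[OF assms] by (intro emeasure_restrict_space) auto
  also have "\<dots> = emeasure lborel {2 powi k ..< 2 powi (k + 1) :: real}" by simp
  also have "\<dots> = ennreal (2 powi (k + 1) - 2 powi k)"
    by (intro emeasure_lborel_Ico power_int_increasing) auto
  finally show ?thesis by (simp add: power_int_add)
qed

section \<open>Comparing sums of dilations at two families of parameters\<close>

context orlicz_delta2
begin

text \<open>Where the value at \<open>\<tau>' n\<close> exceeds the one at \<open>\<tau> n\<close>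
  by at most a factor \<open>D * C\<close>, terms are compared one by one. The other indices are
  grouped by the binary size of \<open>s n\<close>: a group of size x has at most K x^(-1/2)
  members, each with a term of at most x, and the contributions K x^(1/2) form a convergent
  geometric series. Its sum does not depend on the data, which explains the summand 1.\<close>

lemma oscillation_sum_bound:
  assumes b: "bounded_oscillation F c C K (1 / 2)" and C: "C > 1" and K: "K > 0" and c: "c > 0"
  obtains M where "M > 0" and "\<And>(N :: int set) \<tau> \<tau>' s. finite N \<Longrightarrow>
    \<forall>n\<in>N. 0 < s n \<and> s n \<le> 1 \<and> c \<le> \<tau> n \<and> c \<le> \<tau>' n \<Longrightarrow>
    \<forall>m\<in>N. \<forall>n\<in>N. m < n \<longrightarrow> max (\<tau> n) (\<tau>' n) \<le> min (\<tau> m) (\<tau>' m) \<Longrightarrow>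
    (\<Sum>n\<in>N. \<phi> (\<tau>' n) (s n)) \<le> M * (1 + (\<Sum>n\<in>N. \<phi> (\<tau> n) (s n)))"
proof -
  \<comment> \<open>Ratio of the group contributions K x^(1/2), where x = 2^(-i).\<close>
  define q :: real where "q = sqrt (1 / 2)"
  have q: "0 < q" "q < 1" by (auto simp: q_def)
  define M where "M = D * C + K * (\<Sum>j. q ^ j)"
  have bound: "(\<Sum>n\<in>N. \<phi> (\<tau>' n) (s n)) \<le> M * (1 + (\<Sum>n\<in>N. \<phi> (\<tau> n) (s n)))"
    if N: "finite N" and pos: "\<forall>n\<in>N. 0 < s n \<and> s n \<le> 1 \<and> c \<le> \<tau> n \<and> c \<le> \<tau>' n"
      and sep: "\<forall>m\<in>N. \<forall>n\<in>N. m < n \<longrightarrow> max (\<tau> n) (\<tau>' n) \<le> min (\<tau> m) (\<tau>' m)"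
    for N :: "int set" and \<tau> \<tau>' s
  proof -
    have cc: "0 < s n" "s n \<le> 1" "c \<le> \<tau> n" "c \<le> \<tau>' n" "0 < \<tau> n" "0 < \<tau>' n" if "n \<in> N" for n
      using pos that c by force+
    \<comment> \<open>The extra factor \<open>D\<close> pays for replacing \<open>s n\<close> by the
      common value \<open>x\<close> of its group.\<close>
    define B where "B = {n\<in>N. D * C * \<phi> (\<tau> n) (s n) < \<phi> (\<tau>' n) (s n)}"
    define j where "j n = nat \<lfloor>log 2 (1 / s n)\<rfloor>" for n
    have j: "s n \<le> (1 / 2) ^ j n" "(1 / 2) ^ j n \<le> 2 * s n" if n: "n \<in> N" for n
    proof -
      have "0 \<le> log 2 (1 / s n)" using cc[OF n] by simp
      then have "real (j n) \<le> log 2 (1 / s n)" "log 2 (1 / s n) \<le> real (Suc (j n))"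
        unfolding j_def by linarith+
      then have "2 powr real (j n) \<le> 1 / s n" "1 / s n \<le> 2 powr real (Suc (j n))"
        using cc[OF n] le_log_iff[of 2 "1 / s n" "real (j n)"]
          log_le_iff[of 2 "1 / s n" "real (Suc (j n))"] by auto
      then have "2 ^ j n \<le> 1 / s n" "1 / s n \<le> 2 ^ Suc (j n)"
        by (simp_all only: powr_realpow zero_less_numeral)
      then show "s n \<le> (1 / 2) ^ j n" "(1 / 2) ^ j n \<le> 2 * s n"
        using cc[OF n] by (auto simp: field_simps)
    qed
    have B_sum: "(\<Sum>n\<in>B. \<phi> (\<tau>' n) (s n)) \<le> K * (\<Sum>j. q ^ j)"
    proof -
      have group: "(\<Sum>n\<in>{n\<in>B. j n = i}. \<phi> (\<tau>' n) (s n)) \<le> K * q ^ i" for i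
      proof -
        define x :: real where "x = (1 / 2) ^ i"
        have x: "0 < x" "x \<le> 1" by (auto simp: x_def power_le_one)
        define G where "G = {n\<in>B. j n = i}"
        have G: "n \<in> N" "D * C * \<phi> (\<tau> n) (s n) < \<phi> (\<tau>' n) (s n)" "s n \<le> x" "x \<le> 2 * s n"
          if "n \<in> G" for n using that j by (auto simp: G_def B_def x_def)
        let ?p = "\<lambda>n. (min (\<tau> n) (\<tau>' n), max (\<tau> n) (\<tau>' n))"
        have osc: "C * \<phi> (\<tau> n) x \<le> \<phi> (\<tau>' n) x" if n: "n \<in> G" for n
        proof -
          note cn = cc[OF G(1)[OF n]]
          have "\<phi> (\<tau> n) x \<le> \<phi> (\<tau> n) (2 ^ 1 * s n)" using G(4)[OF n] cn x by (intro \<phi>_mono) auto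
          also have "\<dots> \<le> D ^ 1 * \<phi> (\<tau> n) (s n)" using cn by (intro \<phi>_pow2_le) auto
          finally have "C * \<phi> (\<tau> n) x \<le> D * C * \<phi> (\<tau> n) (s n)" using C by simp
          also have "\<dots> \<le> \<phi> (\<tau>' n) (s n)" using G(2)[OF n] by simp
          also have "\<dots> \<le> \<phi> (\<tau>' n) x" using G(3)[OF n] cn by (intro \<phi>_mono) auto
          finally show ?thesis .
        qed
        have lt: "fst (?p n) < snd (?p n)" if n: "n \<in> G" for n
        proof -
          have "\<phi> (\<tau> n) x > 0" using cc[OF G(1)[OF n]] x by (intro \<phi>_pos) auto
          then have "\<phi> (\<tau> n) x < C * \<phi> (\<tau> n) x" using C by simp
          then have "\<tau> n \<noteq> \<tau>' n" using osc[OF n] by auto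
          then show ?thesis by auto
        qed
        have sep': "snd (?p m) \<le> fst (?p n) \<or> snd (?p n) \<le> fst (?p m)"
          if "m \<in> G" "n \<in> G" "m \<noteq> n" for m n
          using sep G(1)[OF that(1)] G(1)[OF that(2)] that(3) by (metis fst_conv snd_conv linorder_neqE)
        have inj: "inj_on ?p G"
        proof (rule inj_onI, rule ccontr)
          fix m n assume "m \<in> G" "n \<in> G" "?p m = ?p n" "m \<noteq> n"
          then show False using sep'[of m n] lt[of m] lt[of n] by (metis not_less)
        qed
        have "finite G" using N by (auto simp: G_def B_def)
        have "separated c (?p ` G)"
          unfolding separated_def
        proof (intro conjI ballI impI)
          show "finite (?p ` G)" using \<open>finite G\<close> by simp
          show "c \<le> fst p" "fst p < snd p" if "p \<in> ?p ` G" for p using that lt cc G(1) by force+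
          show "snd p \<le> fst p' \<or> snd p' \<le> fst p" if "p \<in> ?p ` G" "p' \<in> ?p ` G" "p \<noteq> p'" for p p'
            using that sep' by blast
        qed
        moreover have "\<forall>p\<in>?p ` G. oscillates F x C p"
        proof
          fix p assume "p \<in> ?p ` G"
          then obtain n where "p = ?p n" "n \<in> G" by auto
          then show "oscillates F x C p"
            using osc[of n] by (cases "\<tau> n \<le> \<tau>' n") (auto simp: oscillates_def min_def max_def)
        qed
        ultimately have "real (card (?p ` G)) \<le> K * x powr (- (1 / 2))"
          using b x unfolding bounded_oscillation_def by blast
        then have card: "real (card G) \<le> K * x powr (- (1 / 2))" by (simp add: card_image[OF inj])
        have "\<phi> (\<tau>' n) (s n) \<le> x" if n: "n \<in> G" for n
          using \<phi>_le[of "\<tau>' n" "s n"] cc[OF G(1)[OF n]] G(3)[OF n] by simp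
        then have "(\<Sum>n\<in>G. \<phi> (\<tau>' n) (s n)) \<le> real (card G) * x"
          using sum_bounded_above[of G "\<lambda>n. \<phi> (\<tau>' n) (s n)" x] by simp
        also have "\<dots> \<le> K * x powr (- (1 / 2)) * x" using card x by (intro mult_right_mono) auto
        also have "x powr (- (1 / 2)) * x = q ^ i"
        proof -
          have "x powr (- (1 / 2)) * x = x powr (- (1 / 2)) * x powr 1" using x by simp
          also have "\<dots> = x powr (- (1 / 2) + 1)" by (rule powr_add[symmetric])
          also have "\<dots> = sqrt x" using x by (simp add: powr_half_sqrt)
          finally show ?thesis by (simp add: x_def q_def real_sqrt_power)
        qed
        then have "K * x powr (- (1 / 2)) * x = K * q ^ i" by (simp add: mult.assoc)
        finally show ?thesis by (simp add: G_def)
      qed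
      have "(\<Sum>n\<in>B. \<phi> (\<tau>' n) (s n)) = (\<Sum>i\<in>j ` B. \<Sum>n\<in>{n\<in>B. j n = i}. \<phi> (\<tau>' n) (s n))"
        using N by (intro sum.image_gen) (auto simp: B_def)
      also have "\<dots> \<le> (\<Sum>i\<in>j ` B. K * q ^ i)" by (intro sum_mono group)
      also have "\<dots> = K * (\<Sum>i\<in>j ` B. q ^ i)" by (simp add: sum_distrib_left)
      also have "\<dots> \<le> K * (\<Sum>i. q ^ i)"
        using N K q by (intro mult_left_mono sum_le_suminf summable_geometric) (auto simp: B_def)
      finally show ?thesis .
    qed
    have nonneg: "0 \<le> \<phi> (\<tau> n) (s n)" "0 \<le> \<phi> (\<tau>' n) (s n)" if "n \<in> N" for n
      using cc[OF that] by (auto intro!: less_imp_le \<phi>_pos)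
    have "(\<Sum>n\<in>N. \<phi> (\<tau>' n) (s n)) = (\<Sum>n\<in>N - B. \<phi> (\<tau>' n) (s n)) + (\<Sum>n\<in>B. \<phi> (\<tau>' n) (s n))"
      using N by (intro sum.subset_diff) (auto simp: B_def)
    also have "(\<Sum>n\<in>N - B. \<phi> (\<tau>' n) (s n)) \<le> (\<Sum>n\<in>N - B. D * C * \<phi> (\<tau> n) (s n))"
      by (intro sum_mono) (auto simp: B_def)
    also have "\<dots> = D * C * (\<Sum>n\<in>N - B. \<phi> (\<tau> n) (s n))" by (simp add: sum_distrib_left)
    also have "\<dots> \<le> D * C * (\<Sum>n\<in>N. \<phi> (\<tau> n) (s n))"
      using N C D_ge_2 nonneg by (intro mult_left_mono sum_mono2) auto
    finally have "(\<Sum>n\<in>N. \<phi> (\<tau>' n) (s n))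
        \<le> D * C * (\<Sum>n\<in>N. \<phi> (\<tau> n) (s n)) + K * (\<Sum>j. q ^ j)" using B_sum by simp
    moreover have "0 \<le> (\<Sum>n\<in>N. \<phi> (\<tau> n) (s n))" by (intro sum_nonneg nonneg)
    moreover have "0 \<le> K * (\<Sum>j. q ^ j)"
      using K q by (intro mult_nonneg_nonneg suminf_nonneg summable_geometric) auto
    moreover have "0 \<le> D * C" using D_ge_2 C by simp
    moreover from calculation(3,2)
    have "0 \<le> K * (\<Sum>j. q ^ j) * (\<Sum>n\<in>N. \<phi> (\<tau> n) (s n))" by (rule mult_nonneg_nonneg)
    ultimately show ?thesis unfolding M_def distrib_left distrib_right by linarith
  qed
  have "M > 0"
  proof -
    have "0 \<le> K * (\<Sum>j. q ^ j)"
      using K q by (intro mult_nonneg_nonneg suminf_nonneg summable_geometric) auto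
    then show ?thesis using D_ge_2 C by (simp add: M_def add_pos_nonneg)
  qed
  then show thesis using bound by (rule that)
qed

section \<open>The modular and the norm\<close>

text \<open>The integral of F(|f|) for the step function f of \<open>x\<close>, since [2^k, 2^(k+1))
  has length 2^k. Finite supports are meant; for an infinite one the sum is 0 by convention.\<close>

definition modular :: "(int \<Rightarrow> real) \<Rightarrow> real" where
  "modular x = (\<Sum>k\<in>supp x. 2 powi k * F \<bar>x k\<bar>)"

lemma modular_eq_sum:
  assumes "finite S" "S \<subseteq> {..<0}" "supp x \<subseteq> S"
  shows "modular x = (\<Sum>k\<in>S. 2 powi k * F \<bar>x k\<bar>)"
  unfolding modular_def using assms
  by (intro sum.mono_neutral_left) (auto simp: support_on_def F_zero)

lemma supp_scale: "s \<noteq> 0 \<Longrightarrow> supp (\<lambda>k. s * x k) = supp x"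
  by (auto simp: support_on_def)

lemma supp_subset: "supp x \<subseteq> {..<0}"
  by (auto simp: support_on_def)

lemma modular_scale:
  assumes "finite (supp x)"
  shows "modular (\<lambda>k. s * x k) = (\<Sum>k\<in>supp x. 2 powi k * F (\<bar>s\<bar> * \<bar>x k\<bar>))"
  using modular_eq_sum[OF assms supp_subset, of "\<lambda>k. s * x k"]
  by (auto simp: support_on_def abs_mult)

lemma modular_nonneg: "0 \<le> modular x"
  unfolding modular_def by (intro sum_nonneg) (auto simp: F_nonneg)

lemma modular_scale_mono:
  assumes "finite (supp x)" "\<bar>s\<bar> \<le> \<bar>u\<bar>"
  shows "modular (\<lambda>k. s * x k) \<le> modular (\<lambda>k. u * x k)"
  unfolding modular_scale[OF assms(1)] using assms(2)
  by (intro sum_mono mult_left_mono F_mono mult_right_mono) auto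

lemma modular_scale_le:
  assumes "finite (supp x)" "0 \<le> s" "s \<le> 1"
  shows "modular (\<lambda>k. s * x k) \<le> s * modular x"
proof -
  have "modular (\<lambda>k. s * x k) = (\<Sum>k\<in>supp x. 2 powi k * F (s * \<bar>x k\<bar>))"
    using modular_scale[OF assms(1), of s] assms by simp
  also have "\<dots> \<le> (\<Sum>k\<in>supp x. 2 powi k * (s * F \<bar>x k\<bar>))"
    using assms by (intro sum_mono mult_left_mono F_mult_le) auto
  finally show ?thesis by (simp add: modular_def sum_distrib_left mult.left_commute)
qed

lemma modular_scale_ge:
  assumes "finite (supp x)" "1 \<le> s"
  shows "s * modular x \<le> modular (\<lambda>k. s * x k)"
proof -
  have "s * modular x = (\<Sum>k\<in>supp x. 2 powi k * (s * F \<bar>x k\<bar>))"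
    by (simp add: modular_def sum_distrib_left mult.left_commute)
  also have "\<dots> \<le> (\<Sum>k\<in>supp x. 2 powi k * F (s * \<bar>x k\<bar>))"
    using assms by (intro sum_mono mult_left_mono F_mult_ge) auto
  finally show ?thesis using modular_scale[OF assms(1), of s] assms by simp
qed

lemma modular_pow2_le:
  assumes "finite (supp x)"
  shows "modular (\<lambda>k. 2 ^ n * x k) \<le> D ^ n * modular x"
proof -
  have "modular (\<lambda>k. 2 ^ n * x k) = (\<Sum>k\<in>supp x. 2 powi k * F (2 ^ n * \<bar>x k\<bar>))"
    using modular_scale[OF assms(1), of "2 ^ n"] by simp
  also have "\<dots> \<le> (\<Sum>k\<in>supp x. 2 powi k * (D ^ n * F \<bar>x k\<bar>))"
    by (intro sum_mono mult_left_mono F_pow2_le) auto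
  finally show ?thesis by (simp add: modular_def sum_distrib_left mult.left_commute)
qed

text \<open>Convexity on the segment from \<open>y\<close> to \<open>2 * y\<close>. A dilation close
  to 1 thus costs a factor close to 1, which doubling alone does not give; this makes the infimum in
  the norm attained.\<close>

lemma F_near:
  assumes "0 \<le> \<epsilon>" "\<epsilon> \<le> 1" "0 \<le> y"
  shows "F ((1 + \<epsilon>) * y) \<le> (1 + \<epsilon> * D) * F y"
proof -
  have "convex_on {0..} F" using orlicz by (simp add: orlicz_function_def)
  from convex_onD[OF this, of \<epsilon> y "2 * y"] assms
  have "F ((1 - \<epsilon>) * y + \<epsilon> * (2 * y)) \<le> (1 - \<epsilon>) * F y + \<epsilon> * F (2 * y)" by simp
  also have "(1 - \<epsilon>) * y + \<epsilon> * (2 * y) = (1 + \<epsilon>) * y" by (simp add: algebra_simps)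
  also have "(1 - \<epsilon>) * F y + \<epsilon> * F (2 * y) \<le> 1 * F y + \<epsilon> * (D * F y)"
    using assms doubling[of y] F_nonneg[of y] F_nonneg[of "2 * y"] by (intro add_mono mult_mono) auto
  finally show ?thesis by (simp add: algebra_simps)
qed

lemma modular_near:
  assumes "finite (supp x)" "0 \<le> \<epsilon>" "\<epsilon> \<le> 1"
  shows "modular (\<lambda>k. (1 + \<epsilon>) * x k) \<le> (1 + \<epsilon> * D) * modular x"
proof -
  have "modular (\<lambda>k. (1 + \<epsilon>) * x k) = (\<Sum>k\<in>supp x. 2 powi k * F ((1 + \<epsilon>) * \<bar>x k\<bar>))"
    using modular_scale[OF assms(1), of "1 + \<epsilon>"] assms by simp
  also have "\<dots> \<le> (\<Sum>k\<in>supp x. 2 powi k * ((1 + \<epsilon> * D) * F \<bar>x k\<bar>))"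
    using assms by (intro sum_mono mult_left_mono F_near) auto
  finally show ?thesis by (simp add: modular_def sum_distrib_left mult.left_commute)
qed

text \<open>At each point at most one dyadic interval is active, so \<open>F\<close> passes through
  the sum.\<close>

lemma nn_integral_step_function:
  assumes fin: "finite (supp x)" and "0 < \<alpha>"
  shows "(\<integral>\<^sup>+ t. ennreal (F (inverse \<alpha> * \<bar>step_function x t\<bar>)) \<partial>lebesgue_on {0..1})
    = ennreal (modular (\<lambda>k. inverse \<alpha> * x k))"
proof -
  let ?I = "\<lambda>k::int. {2 powi k ..< 2 powi (k + 1) :: real}"
  define S where "S = supp x"
  have S: "finite S" "S \<subseteq> {..<0}" using fin supp_subset by (auto simp: S_def)
  have ptw: "ennreal (F (inverse \<alpha> * \<bar>step_function x t\<bar>))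
      = (\<Sum>k\<in>S. ennreal (F (inverse \<alpha> * \<bar>x k\<bar>)) * indicator (?I k) t)" for t
  proof (cases "\<exists>k\<in>S. t \<in> ?I k")
    case True
    then obtain k where k: "k \<in> S" "t \<in> ?I k" by auto
    have off: "indicator (?I l) t = (0 :: 'a :: zero_neq_one)" if "l \<noteq> k" for l
      using powi_interval_unique[of k t l] k that by (auto simp: indicator_def)
    have single: "sum g {k} = g k" for g :: "int \<Rightarrow> 'b :: comm_monoid_add" by simp
    have "step_function x t = (\<Sum>l\<in>S. x l * indicator (?I l) t)"
      using S by (intro step_function_eq_sum) (auto simp: S_def)
    also have "\<dots> = (\<Sum>l\<in>{k}. x l * indicator (?I l) t)"
      using S k off by (intro sum.mono_neutral_right) auto
    finally have "step_function x t = x k" using k unfolding single by simp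
    moreover have "(\<Sum>l\<in>S. ennreal (F (inverse \<alpha> * \<bar>x l\<bar>)) * indicator (?I l) t)
        = (\<Sum>l\<in>{k}. ennreal (F (inverse \<alpha> * \<bar>x l\<bar>)) * indicator (?I l) t)"
      using S k off by (intro sum.mono_neutral_right) auto
    ultimately show ?thesis using k unfolding single by simp
  next
    case False
    then have off: "indicator (?I l) t = (0 :: 'a :: zero_neq_one)" if "l \<in> S" for l
      using that by (auto simp: indicator_def)
    have "step_function x t = (\<Sum>l\<in>S. x l * indicator (?I l) t)"
      using S by (intro step_function_eq_sum) (auto simp: S_def)
    also have "\<dots> = 0" using off by (intro sum.neutral) auto
    finally have "step_function x t = 0" .
    moreover have "(\<Sum>k\<in>S. ennreal (F (inverse \<alpha> * \<bar>x k\<bar>)) * indicator (?I k) t) = 0"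
      using off by (intro sum.neutral) auto
    ultimately show ?thesis by (simp add: F_zero)
  qed
  have meas: "?I k \<in> sets (lebesgue_on {0..1})" if "k \<in> S" for k
    using that S dyadic_interval_subset[of k] by (auto simp: sets_restrict_space_iff)
  have "(\<integral>\<^sup>+ t. ennreal (F (inverse \<alpha> * \<bar>step_function x t\<bar>)) \<partial>lebesgue_on {0..1})
      = (\<Sum>k\<in>S. \<integral>\<^sup>+ t. ennreal (F (inverse \<alpha> * \<bar>x k\<bar>)) * indicator (?I k) t \<partial>lebesgue_on {0..1})"
    unfolding ptw
    by (intro nn_integral_sum borel_measurable_times_ennreal borel_measurable_const
        borel_measurable_indicator meas)
  also have "\<dots> = (\<Sum>k\<in>S. ennreal (F (inverse \<alpha> * \<bar>x k\<bar>)) * emeasure (lebesgue_on {0..1}) (?I k))"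
    by (intro sum.cong refl nn_integral_cmult_indicator meas)
  also have "\<dots> = (\<Sum>k\<in>S. ennreal (2 powi k * F (inverse \<alpha> * \<bar>x k\<bar>)))"
  proof (rule sum.cong[OF refl])
    fix k assume "k \<in> S"
    then show "ennreal (F (inverse \<alpha> * \<bar>x k\<bar>)) * emeasure (lebesgue_on {0..1}) (?I k)
        = ennreal (2 powi k * F (inverse \<alpha> * \<bar>x k\<bar>))"
      using S assms(2) by (subst emeasure_dyadic_interval)
        (auto simp: ennreal_mult mult.commute F_nonneg)
  qed
  also have "\<dots> = ennreal (\<Sum>k\<in>S. 2 powi k * F (inverse \<alpha> * \<bar>x k\<bar>))"
    using assms by (intro sum_ennreal) (auto intro!: mult_nonneg_nonneg F_nonneg)
  finally show ?thesis using modular_scale[OF fin, of "inverse \<alpha>"] assms(2) by (simp add: S_def)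
qed

lemma step_function_measurable:
  assumes "finite (supp x)"
  shows "step_function x \<in> borel_measurable (lebesgue_on {0..1})"
proof -
  have "step_function x = (\<lambda>t. \<Sum>k\<in>supp x. x k * indicator {2 powi k ..< 2 powi (k + 1)} t)"
    using step_function_eq_sum[OF assms supp_subset order_refl] by auto
  moreover have "(\<lambda>t::real. \<Sum>k\<in>supp x. x k * indicator {2 powi k ..< 2 powi (k + 1)} t)
      \<in> borel_measurable (lebesgue_on {0..1})"
    by (intro borel_measurable_sum borel_measurable_times borel_measurable_const
        measurable_restrict_space1 borel_measurable_indicator) auto
  ultimately show ?thesis by simp
qed

lemma seq_norm_eq_Inf:
  assumes "finite (supp x)"
  shows "seq_norm (orlicz_norm F) x
    = Inf {ennreal \<alpha> | \<alpha>. \<alpha> > 0 \<and> modular (\<lambda>k. inverse \<alpha> * x k) \<le> 1}"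
proof -
  have "((\<integral>\<^sup>+ t. ennreal (F (inverse \<alpha> * \<bar>step_function x t\<bar>)) \<partial>lebesgue_on {0..1}) \<le> 1)
      \<longleftrightarrow> modular (\<lambda>k. inverse \<alpha> * x k) \<le> 1" if "\<alpha> > 0" for \<alpha>
    by (simp add: nn_integral_step_function[OF assms that])
  then have "{ennreal \<alpha> | \<alpha>. \<alpha> > 0 \<and>
       (\<integral>\<^sup>+ t. ennreal (F (inverse \<alpha> * \<bar>step_function x t\<bar>)) \<partial>lebesgue_on {0..1}) \<le> 1}
      = {ennreal \<alpha> | \<alpha>. \<alpha> > 0 \<and> modular (\<lambda>k. inverse \<alpha> * x k) \<le> 1}" by blast
  then show ?thesis
    using step_function_measurable[OF assms] by (simp add: seq_norm_def orlicz_norm_def)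
qed

text \<open>The infimum is attained: an admissible \<open>\<alpha>\<close> below a (1 + \<epsilon>)
  bounds the modular at \<open>a\<close> by 1 + \<epsilon> D, and \<epsilon> tends to 0.\<close>

lemma seq_norm_le_iff:
  assumes fin: "finite (supp x)" and a: "0 < a"
  shows "seq_norm (orlicz_norm F) x \<le> ennreal a \<longleftrightarrow> modular (\<lambda>k. inverse a * x k) \<le> 1"
proof
  assume "modular (\<lambda>k. inverse a * x k) \<le> 1"
  then show "seq_norm (orlicz_norm F) x \<le> ennreal a"
    unfolding seq_norm_eq_Inf[OF fin] using a by (intro Inf_lower) auto
next
  assume le: "seq_norm (orlicz_norm F) x \<le> ennreal a"
  have near: "modular (\<lambda>k. inverse a * x k) \<le> 1 + \<epsilon> * D" if \<epsilon>: "0 < \<epsilon>" "\<epsilon> \<le> 1" for \<epsilon>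
  proof -
    have "seq_norm (orlicz_norm F) x < ennreal (a * (1 + \<epsilon>))"
      using le a \<epsilon> by (intro le_less_trans[OF le]) (auto simp: ennreal_less_iff)
    then obtain \<alpha> where \<alpha>: "ennreal \<alpha> < ennreal (a * (1 + \<epsilon>))" "\<alpha> > 0"
      "modular (\<lambda>k. inverse \<alpha> * x k) \<le> 1"
      unfolding seq_norm_eq_Inf[OF fin] Inf_less_iff by auto
    then have "\<alpha> \<le> a * (1 + \<epsilon>)" by (simp add: ennreal_less_iff)
    then have "inverse a \<le> (1 + \<epsilon>) * inverse \<alpha>" using a \<alpha> by (simp add: field_simps)
    then have "modular (\<lambda>k. inverse a * x k) \<le> modular (\<lambda>k. ((1 + \<epsilon>) * inverse \<alpha>) * x k)"
      using a \<alpha> \<epsilon> by (intro modular_scale_mono[OF fin]) auto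
    also have "\<dots> = modular (\<lambda>k. (1 + \<epsilon>) * (inverse \<alpha> * x k))" by (simp add: mult.assoc)
    also have "\<dots> \<le> (1 + \<epsilon> * D) * modular (\<lambda>k. inverse \<alpha> * x k)"
      using fin \<alpha> \<epsilon> by (intro modular_near) (auto simp: supp_scale)
    also have "\<dots> \<le> (1 + \<epsilon> * D) * 1" using \<alpha> \<epsilon> D_ge_2 by (intro mult_left_mono) auto
    finally show ?thesis by simp
  qed
  show "modular (\<lambda>k. inverse a * x k) \<le> 1"
  proof (rule field_le_epsilon)
    fix e :: real assume "0 < e"
    then have "modular (\<lambda>k. inverse a * x k) \<le> 1 + min 1 (e / D) * D"
      using D_ge_2 by (intro near) auto
    also have "min 1 (e / D) * D \<le> e / D * D" using D_ge_2 by (intro mult_right_mono) auto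
    finally show "modular (\<lambda>k. inverse a * x k) \<le> 1 + e" using D_ge_2 by simp
  qed
qed

lemma seq_norm_le_1_iff:
  "finite (supp x) \<Longrightarrow> seq_norm (orlicz_norm F) x \<le> 1 \<longleftrightarrow> modular x \<le> 1"
  using seq_norm_le_iff[of x 1] by simp

text \<open>If the modular were below 1, doubling would leave room for a slight dilation, so the
  norm would be below 1. If the modular is 1, convexity makes that of any proper dilation exceed
  1.\<close>

lemma seq_norm_eq_1_iff:
  assumes fin: "finite (supp x)"
  shows "seq_norm (orlicz_norm F) x = 1 \<longleftrightarrow> modular x = 1"
proof
  assume eq: "seq_norm (orlicz_norm F) x = 1"
  then have "modular x \<le> 1" using seq_norm_le_1_iff[OF fin] by simp
  moreover have "\<not> modular x < 1"
  proof
    assume lt: "modular x < 1"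
    \<comment> \<open>With d = 1 - modular x, the bound for the dilated modular becomes (1 + d)(1 -
      d), which is at most 1.\<close>
    define \<epsilon> where "\<epsilon> = (1 - modular x) / D"
    have \<epsilon>: "0 < \<epsilon>" "\<epsilon> \<le> 1" using lt D_ge_2 modular_nonneg[of x] by (auto simp: \<epsilon>_def field_simps)
    have "modular (\<lambda>k. inverse (inverse (1 + \<epsilon>)) * x k) \<le> (1 + \<epsilon> * D) * modular x"
      using modular_near[OF fin, of \<epsilon>] \<epsilon> by simp
    also have "\<dots> = (1 + (1 - modular x)) * (1 - (1 - modular x))" using D_ge_2 by (simp add: \<epsilon>_def)
    also have "\<dots> = 1 - (1 - modular x)\<^sup>2" by (simp add: algebra_simps power2_eq_square)
    also have "\<dots> \<le> 1" by simp
    finally have "seq_norm (orlicz_norm F) x \<le> ennreal (inverse (1 + \<epsilon>))"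
      using seq_norm_le_iff[OF fin, of "inverse (1 + \<epsilon>)"] \<epsilon> by simp
    also have "\<dots> < ennreal 1" using \<epsilon> by (intro ennreal_lessI) (auto simp: field_simps)
    finally show False using eq by simp
  qed
  ultimately show "modular x = 1" by simp
next
  assume eq: "modular x = 1"
  then have le: "seq_norm (orlicz_norm F) x \<le> 1" using seq_norm_le_1_iff[OF fin] by simp
  moreover have "\<not> seq_norm (orlicz_norm F) x < 1"
  proof
    assume "seq_norm (orlicz_norm F) x < 1"
    then obtain \<alpha> where \<alpha>: "ennreal \<alpha> < 1" "\<alpha> > 0" "modular (\<lambda>k. inverse \<alpha> * x k) \<le> 1"
      unfolding seq_norm_eq_Inf[OF fin] Inf_less_iff by auto
    then have "\<alpha> < 1" by (metis ennreal_1 ennreal_less_iff less_imp_le)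
    then have "1 < inverse \<alpha>" using \<alpha> by (simp add: one_less_inverse)
    then have "inverse \<alpha> * modular x \<le> modular (\<lambda>k. inverse \<alpha> * x k)"
      by (intro modular_scale_ge fin) auto
    then show False using \<alpha> eq \<open>1 < inverse \<alpha>\<close> by simp
  qed
  ultimately show "seq_norm (orlicz_norm F) x = 1" by simp
qed

end

section \<open>Shift properties from elasticity\<close>

context orlicz_delta2
begin

definition height :: "int \<Rightarrow> real" where
  "height k = (SOME t. 0 \<le> t \<and> F t = 2 powi (- k))"

lemma F_height: "F (height k) = 2 powi (- k)" and height_pos: "0 < height k"
proof -
  have "\<exists>t. 0 \<le> t \<and> F t = 2 powi (- k)" using F_surj[of "2 powi (- k)"] by auto
  then have *: "0 \<le> height k \<and> F (height k) = 2 powi (- k)" unfolding height_def by (rule someI_ex)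
  then show "F (height k) = 2 powi (- k)" by simp
  then have "height k \<noteq> 0" using F_zero by (auto simp del: power_int_minus)
  with * show "0 < height k" by simp
qed

lemma F_height_mult: "2 powi k * F (height k) = 1"
  unfolding F_height by (simp add: power_int_minus)

lemma height_antimono: "k \<le> l \<Longrightarrow> height l \<le> height k"
  using F_le_iff[of "height l" "height k"] height_pos[of k] height_pos[of l]
    power_int_increasing[of "- l" "- k" "2::real"]
  by (simp add: F_height del: power_int_minus)

text \<open>A modular of at most 1 bounds each coordinate by the height at its own position, and
  heights decrease along the support.\<close>

lemma le_height_Min:
  assumes "finite (supp x)" "modular x \<le> 1" "k \<in> supp x"
  shows "\<bar>x k\<bar> \<le> height (Min (supp x))"
proof -
  have "2 powi k * F \<bar>x k\<bar> \<le> modular x"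
    unfolding modular_def using assms by (intro member_le_sum) (auto simp: F_nonneg)
  then have "2 powi k * F \<bar>x k\<bar> \<le> 2 powi k * F (height k)"
    using assms(2) F_height_mult[of k] by simp
  then have "F \<bar>x k\<bar> \<le> F (height k)" by simp
  then have "\<bar>x k\<bar> \<le> height k" using F_le_iff height_pos[of k] by simp
  also have "\<dots> \<le> height (Min (supp x))" using assms by (intro height_antimono) auto
  finally show ?thesis .
qed

text \<open>Coordinates with \<^term>\<open>F \<bar>v k\<bar> < 2 powi (- B) / 4\<close>, where \<open>B\<close> is the last point of the
  support, carry at most half of the modular.\<close>

lemma modular_scale_lower:
  assumes fin: "finite (supp v)" and one: "modular v = 1" and s: "0 \<le> s"
  shows "\<exists>t. height (Max (supp v)) \<le> t \<and> t \<le> height (Min (supp v)) \<and>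
    \<phi> t s \<le> 2 * D\<^sup>2 * modular (\<lambda>k. s * v k)"
proof -
  define S B where "S = supp v" and "B = Max S"
  have S: "finite S" "S \<noteq> {}" using fin one by (auto simp: S_def modular_def)
  define G where "G = {k\<in>S. 2 powi (- B) / 4 \<le> F \<bar>v k\<bar>}"
  have G: "finite G" "G \<subseteq> S" using S by (auto simp: G_def)
  have "(\<Sum>k\<in>S - G. 2 powi k * F \<bar>v k\<bar>) \<le> (\<Sum>k\<in>S - G. 2 powi k * (2 powi (- B) / 4))"
    by (intro sum_mono mult_left_mono) (auto simp: G_def)
  also have "\<dots> = (\<Sum>k\<in>S - G. 2 powi k) * (2 powi (- B) / 4)" by (simp add: sum_distrib_right)
  also have "\<dots> \<le> (2 * 2 powi B) * (2 powi (- B) / 4)"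
    using S by (intro mult_right_mono sum_powi_le) (auto simp: B_def)
  also have "\<dots> = 1 / 2" by (simp add: power_int_minus)
  finally have "(\<Sum>k\<in>S - G. 2 powi k * F \<bar>v k\<bar>) \<le> 1 / 2" .
  moreover have "(\<Sum>k\<in>S. 2 powi k * F \<bar>v k\<bar>) = 1" using one by (simp add: modular_def S_def)
  moreover have "(\<Sum>k\<in>S. 2 powi k * F \<bar>v k\<bar>)
      = (\<Sum>k\<in>S - G. 2 powi k * F \<bar>v k\<bar>) + (\<Sum>k\<in>G. 2 powi k * F \<bar>v k\<bar>)"
    using S G by (intro sum.subset_diff)
  ultimately have half: "1 / 2 \<le> (\<Sum>k\<in>G. 2 powi k * F \<bar>v k\<bar>)" by linarith
  then have "G \<noteq> {}" by auto
  \<comment> \<open>\<open>i\<close> minimizes \<open>\<phi> \<bar>v k\<bar> s\<close> over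
    \<open>G\<close>. As \<open>G\<close> carries at least half of the modular, this minimum is at
    most twice the modular of the scaled vector.\<close>
  then obtain i where i: "i \<in> G" "\<And>k. k \<in> G \<Longrightarrow> \<phi> \<bar>v i\<bar> s \<le> \<phi> \<bar>v k\<bar> s"
    using arg_min_if_finite[of G "\<lambda>k. \<phi> \<bar>v k\<bar> s"] G(1) by (metis leI)
  have v_pos: "0 < \<bar>v k\<bar>" if "k \<in> S" for k using that by (auto simp: S_def support_on_def)
  have \<phi>_nonneg: "0 \<le> \<phi> \<bar>v i\<bar> s" using s v_pos[of i] by (simp add: dilate_def F_nonneg)
  have "1 / 2 * \<phi> \<bar>v i\<bar> s \<le> (\<Sum>k\<in>G. 2 powi k * F \<bar>v k\<bar>) * \<phi> \<bar>v i\<bar> s"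
    using half \<phi>_nonneg by (intro mult_right_mono)
  also have "\<dots> = (\<Sum>k\<in>G. 2 powi k * F \<bar>v k\<bar> * \<phi> \<bar>v i\<bar> s)" by (simp add: sum_distrib_right)
  also have "\<dots> \<le> (\<Sum>k\<in>G. 2 powi k * F \<bar>v k\<bar> * \<phi> \<bar>v k\<bar> s)"
    using i(2) by (intro sum_mono mult_left_mono) (auto intro!: mult_nonneg_nonneg F_nonneg)
  also have "\<dots> = (\<Sum>k\<in>G. 2 powi k * F (s * \<bar>v k\<bar>))"
    using G v_pos \<phi>_mult by (intro sum.cong) (auto simp: mult.assoc mult.commute[of s])
  also have "\<dots> \<le> (\<Sum>k\<in>S. 2 powi k * F (s * \<bar>v k\<bar>))"
    using S G s by (intro sum_mono2 mult_nonneg_nonneg F_nonneg) auto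
  also have "\<dots> = modular (\<lambda>k. s * v k)" using modular_scale[OF fin, of s] s by (simp add: S_def)
  finally have low: "\<phi> \<bar>v i\<bar> s \<le> 2 * modular (\<lambda>k. s * v k)" by simp
  \<comment> \<open>The minimizer can lie below \<open>height B\<close>, but only by a factor of at
    most 4; lifting it costs \<open>D\<^sup>2\<close>.\<close>
  define t where "t = max \<bar>v i\<bar> (height B)"
  have iS: "i \<in> S" using i(1) G by auto
  have "F (height B) \<le> 4 * F \<bar>v i\<bar>" using i(1) by (simp add: G_def F_height)
  also have "\<dots> \<le> F (4 * \<bar>v i\<bar>)" by (intro F_mult_ge) auto
  finally have "height B \<le> 2\<^sup>2 * \<bar>v i\<bar>" using F_le_iff height_pos[of B] by simp
  then have "\<phi> t s \<le> D\<^sup>2 * \<phi> \<bar>v i\<bar> s"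
    using v_pos[OF iS] s by (intro \<phi>_comparable) (auto simp: t_def)
  also have "\<dots> \<le> D\<^sup>2 * (2 * modular (\<lambda>k. s * v k))" using low by (intro mult_left_mono) auto
  finally have "\<phi> t s \<le> 2 * D\<^sup>2 * modular (\<lambda>k. s * v k)" by simp
  moreover have "\<bar>v i\<bar> \<le> height (Min (supp v))"
    using le_height_Min[OF fin] one iS by (simp add: S_def)
  moreover have "height B \<le> height (Min (supp v))"
    using S by (intro height_antimono) (auto simp: B_def S_def)
  ultimately show ?thesis by (intro exI[of _ t]) (auto simp: t_def B_def S_def)
qed

text \<open>Coordinates up to \<open>height B\<close> are replaced by \<open>height B\<close>; their
  weights sum to at most 2 * 2^B, which gives twice the value of \<open>\<phi>\<close> there. The
  larger coordinates carry modular at most 1 and so give at most their largest value of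
  \<open>\<phi>\<close>. Hence the factor 3.\<close>

lemma modular_scale_upper:
  assumes fin: "finite (supp w)" and le1: "modular w \<le> 1" and ne: "supp w \<noteq> {}" and s: "0 \<le> s"
  shows "\<exists>t. height (Max (supp w)) \<le> t \<and> t \<le> height (Min (supp w)) \<and>
    modular (\<lambda>k. s * w k) \<le> 3 * \<phi> t s"
proof -
  define S B where "S = supp w" and "B = Max S"
  have S: "finite S" "S \<noteq> {}" using fin ne by (auto simp: S_def)
  define G where "G = {k\<in>S. height B < \<bar>w k\<bar>}"
  have G: "finite G" "G \<subseteq> S" using S by (auto simp: G_def)
  define T where "T = insert (height B) ((\<lambda>k. \<bar>w k\<bar>) ` G)"
  have T: "finite T" "T \<noteq> {}" using G by (auto simp: T_def)
  then obtain t where t: "t \<in> T" "\<And>u. u \<in> T \<Longrightarrow> \<phi> u s \<le> \<phi> t s"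
    using arg_min_if_finite[of T "\<lambda>u. - \<phi> u s"] by (metis leI neg_less_iff_less)
  have t_pos: "0 < t" using t(1) height_pos[of B] by (auto simp: T_def G_def)
  have \<phi>_nonneg: "0 \<le> \<phi> t s" using s t_pos by (simp add: dilate_def F_nonneg)
  have w_pos: "0 < \<bar>w k\<bar>" if "k \<in> S" for k using that by (auto simp: S_def support_on_def)
  have "(\<Sum>k\<in>S - G. 2 powi k * F (s * \<bar>w k\<bar>)) \<le> (\<Sum>k\<in>S - G. 2 powi k * F (s * height B))"
    using s by (intro sum_mono mult_left_mono F_mono) (auto simp: G_def intro: mult_left_mono)
  also have "\<dots> = (\<Sum>k\<in>S - G. 2 powi k) * F (s * height B)" by (simp add: sum_distrib_right)
  also have "\<dots> \<le> (2 * 2 powi B) * F (s * height B)"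
    using S s height_pos[of B] by (intro mult_right_mono sum_powi_le F_nonneg) (auto simp: B_def)
  also have "F (s * height B) = F (height B) * \<phi> (height B) s"
    using \<phi>_mult[of "height B" s] height_pos[of B] by (simp add: mult.commute)
  also have "(2 * 2 powi B) * \<dots> = 2 * \<phi> (height B) s"
    by (simp add: F_height power_int_minus)
  also have "\<dots> \<le> 2 * \<phi> t s" using t(2)[of "height B"] by (simp add: T_def)
  finally have small: "(\<Sum>k\<in>S - G. 2 powi k * F (s * \<bar>w k\<bar>)) \<le> 2 * \<phi> t s" .
  have "(\<Sum>k\<in>G. 2 powi k * F (s * \<bar>w k\<bar>)) = (\<Sum>k\<in>G. 2 powi k * F \<bar>w k\<bar> * \<phi> \<bar>w k\<bar> s)"
    using G w_pos \<phi>_mult by (intro sum.cong) (auto simp: mult.assoc mult.commute[of s])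
  also have "\<dots> \<le> (\<Sum>k\<in>G. 2 powi k * F \<bar>w k\<bar> * \<phi> t s)"
    using t(2) by (intro sum_mono mult_left_mono) (auto intro!: mult_nonneg_nonneg F_nonneg simp: T_def)
  also have "\<dots> = (\<Sum>k\<in>G. 2 powi k * F \<bar>w k\<bar>) * \<phi> t s" by (simp add: sum_distrib_right)
  also have "\<dots> \<le> 1 * \<phi> t s"
  proof (rule mult_right_mono)
    have "(\<Sum>k\<in>G. 2 powi k * F \<bar>w k\<bar>) \<le> (\<Sum>k\<in>S. 2 powi k * F \<bar>w k\<bar>)"
      using S G by (intro sum_mono2 mult_nonneg_nonneg F_nonneg) auto
    then show "(\<Sum>k\<in>G. 2 powi k * F \<bar>w k\<bar>) \<le> 1" using le1 by (simp add: modular_def S_def)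
  qed (rule \<phi>_nonneg)
  finally have large: "(\<Sum>k\<in>G. 2 powi k * F (s * \<bar>w k\<bar>)) \<le> \<phi> t s" by simp
  have "modular (\<lambda>k. s * w k) = (\<Sum>k\<in>S. 2 powi k * F (s * \<bar>w k\<bar>))"
    using modular_scale[OF fin, of s] s by (simp add: S_def)
  also have "\<dots> = (\<Sum>k\<in>S - G. 2 powi k * F (s * \<bar>w k\<bar>)) + (\<Sum>k\<in>G. 2 powi k * F (s * \<bar>w k\<bar>))"
    using S G by (intro sum.subset_diff)
  finally have "modular (\<lambda>k. s * w k) \<le> 3 * \<phi> t s" using small large by linarith
  moreover have "height B \<le> t" using t(1) by (auto simp: T_def G_def)
  moreover have "t \<le> height (Min (supp w))"
  proof -
    have "height B \<le> height (Min (supp w))"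
      using S by (intro height_antimono) (auto simp: B_def S_def)
    then show ?thesis using t(1) G le_height_Min[OF fin le1] by (auto simp: T_def S_def)
  qed
  ultimately show ?thesis by (intro exI[of _ t]) (auto simp: B_def S_def)
qed

section \<open>Linear combinations of disjointly supported sequences\<close>

lemma lin_comb_eq:
  assumes "finite {n\<in>I. \<alpha> n \<noteq> 0}" "n \<in> I" "\<alpha> n \<noteq> 0" "k \<in> supp (x n)"
    and disj: "\<And>m. m \<in> I \<Longrightarrow> m \<noteq> n \<Longrightarrow> supp (x m) \<inter> supp (x n) = {}"
  shows "lin_comb I \<alpha> x k = \<alpha> n * x n k"
proof -
  have zero: "x m k = 0" if "m \<in> I" "m \<noteq> n" for m
    using disj[OF that] assms(4) by (auto simp: support_on_def)
  have "lin_comb I \<alpha> x k = (\<Sum>m\<in>{n}. \<alpha> m * x m k)"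
    unfolding lin_comb_def using assms zero by (intro sum.mono_neutral_right) auto
  then show ?thesis by simp
qed

lemma supp_lin_comb: "supp (lin_comb I \<alpha> x) \<subseteq> (\<Union>n\<in>{n\<in>I. \<alpha> n \<noteq> 0}. supp (x n))"
  by (fastforce simp: support_on_def lin_comb_def intro: sum.neutral)

lemma modular_lin_comb:
  assumes fin: "finite {n\<in>I. \<alpha> n \<noteq> 0}" "\<And>n. n \<in> I \<Longrightarrow> finite (supp (x n))"
    and disj: "\<And>m n. m \<in> I \<Longrightarrow> n \<in> I \<Longrightarrow> m \<noteq> n \<Longrightarrow> supp (x m) \<inter> supp (x n) = {}"
  shows "modular (\<lambda>k. c * lin_comb I \<alpha> x k)
    = (\<Sum>n\<in>{n\<in>I. \<alpha> n \<noteq> 0}. modular (\<lambda>k. (c * \<alpha> n) * x n k))"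
proof -
  define N where "N = {n\<in>I. \<alpha> n \<noteq> 0}"
  define T where "T = (\<Union>n\<in>N. supp (x n))"
  have finT: "finite T" using fin by (auto simp: T_def N_def)
  have "supp (\<lambda>k. c * lin_comb I \<alpha> x k) \<subseteq> T"
    using supp_lin_comb[of I \<alpha> x] by (auto simp: T_def N_def support_on_def)
  then have "modular (\<lambda>k. c * lin_comb I \<alpha> x k) = (\<Sum>k\<in>T. 2 powi k * F \<bar>c * lin_comb I \<alpha> x k\<bar>)"
    using finT by (intro modular_eq_sum) (auto simp: T_def support_on_def)
  also have "\<dots> = (\<Sum>n\<in>N. \<Sum>k\<in>supp (x n). 2 powi k * F \<bar>c * lin_comb I \<alpha> x k\<bar>)"
    unfolding T_def using fin disj by (intro sum.UNION_disjoint) (auto simp: N_def)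
  also have "\<dots> = (\<Sum>n\<in>N. modular (\<lambda>k. (c * \<alpha> n) * x n k))"
  proof (rule sum.cong[OF refl])
    fix n assume n: "n \<in> N"
    have "(\<Sum>k\<in>supp (x n). 2 powi k * F \<bar>c * lin_comb I \<alpha> x k\<bar>)
        = (\<Sum>k\<in>supp (x n). 2 powi k * F (\<bar>c * \<alpha> n\<bar> * \<bar>x n k\<bar>))"
    proof (rule sum.cong[OF refl])
      fix k assume "k \<in> supp (x n)"
      then have "lin_comb I \<alpha> x k = \<alpha> n * x n k"
        using n fin disj by (intro lin_comb_eq) (auto simp: N_def)
      then show "2 powi k * F \<bar>c * lin_comb I \<alpha> x k\<bar> = 2 powi k * F (\<bar>c * \<alpha> n\<bar> * \<bar>x n k\<bar>)"
        by (simp add: abs_mult mult.assoc)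
    qed
    also have "\<dots> = modular (\<lambda>k. (c * \<alpha> n) * x n k)"
      using modular_scale[of "x n" "c * \<alpha> n"] fin(2) n by (simp add: N_def)
    finally show "(\<Sum>k\<in>supp (x n). 2 powi k * F \<bar>c * lin_comb I \<alpha> x k\<bar>)
        = modular (\<lambda>k. (c * \<alpha> n) * x n k)" .
  qed
  finally show ?thesis by (simp add: N_def)
qed

lemma modular_scale_abs:
  "finite (supp x) \<Longrightarrow> modular (\<lambda>k. \<bar>s\<bar> * x k) = modular (\<lambda>k. s * x k)"
  by (intro antisym modular_scale_mono) auto

lemma finite_supp_lin_comb:
  assumes "finite {n\<in>I. \<alpha> n \<noteq> 0}" "\<And>n. n \<in> I \<Longrightarrow> finite (supp (x n))"
  shows "finite (supp (lin_comb I \<alpha> x))"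
  by (rule finite_subset[OF supp_lin_comb]) (use assms in auto)

text \<open>One domination for both shifts: \<open>v\<close> is \<open>x\<close> and
  \<open>w\<close> is \<open>y\<close> for stretchability, the reverse for compressibility. For each
  index the modular of the multiple of \<open>v n\<close> is bounded below, and that of
  \<open>w n\<close> above, by values of \<open>\<phi>\<close> at heights in the range of the
  support; \<open>oscillation_sum_bound\<close> compares the two sums.\<close>

lemma elastic_domination:
  assumes elastic: "elastic_at_infinity F"
  obtains M where "M > 0" and "\<And>I v w \<alpha>. finite {n\<in>I. \<alpha> n \<noteq> 0} \<Longrightarrow>
    \<forall>n\<in>I. finite (supp (v n)) \<and> finite (supp (w n)) \<and> modular (v n) = 1 \<and> modular (w n) \<le> 1 \<Longrightarrow>
    \<forall>m\<in>I. \<forall>n\<in>I. m < n \<longrightarrow>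
       set_before (supp (v m) \<union> supp (w m)) (supp (v n) \<union> supp (w n)) \<Longrightarrow>
    seq_norm (orlicz_norm F) (lin_comb I \<alpha> w)
      \<le> ennreal M * seq_norm (orlicz_norm F) (lin_comb I \<alpha> v)"
proof -
  \<comment> \<open>\<open>height (- 1)\<close> is the least height at a negative index, and it may
    be below 1.\<close>
  define c where "c = min 1 (height (- 1))"
  have c: "0 < c" "c \<le> 1" using height_pos by (auto simp: c_def)
  obtain C0 K0 r where "C0 > 1" "K0 > 1" "r > 0" "bounded_oscillation F 1 C0 K0 r"
    using elastic elastic_at_infinity_iff by blast
  then obtain C K where "C > 1" "K > 0" "bounded_oscillation F c C K (1 / 2)"
    using bounded_oscillation_sqrt[of C0 K0 r c] c by auto
  then obtain M where M: "M > 0" and core: "\<And>(N :: int set) \<tau> \<tau>' s. finite N \<Longrightarrow>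
    \<forall>n\<in>N. 0 < s n \<and> s n \<le> 1 \<and> c \<le> \<tau> n \<and> c \<le> \<tau>' n \<Longrightarrow>
    \<forall>m\<in>N. \<forall>n\<in>N. m < n \<longrightarrow> max (\<tau> n) (\<tau>' n) \<le> min (\<tau> m) (\<tau>' m) \<Longrightarrow>
    (\<Sum>n\<in>N. \<phi> (\<tau>' n) (s n)) \<le> M * (1 + (\<Sum>n\<in>N. \<phi> (\<tau> n) (s n)))"
    using oscillation_sum_bound[of c C K] c(1) by blast
  \<comment> \<open>3 comes from \<open>modular_scale_upper\<close> and \<open>2 * D\<^sup>2\<close>
    from \<open>modular_scale_lower\<close>; the maximum with 1 permits dividing by \<open>L\<close>
    through convexity.\<close>
  define L where "L = max 1 (3 * (M * (1 + 2 * D\<^sup>2)))"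
  have L: "1 \<le> L" "3 * (M * (1 + 2 * D\<^sup>2)) \<le> L" by (auto simp: L_def)
  have bound: "seq_norm (orlicz_norm F) (lin_comb I \<alpha> w)
      \<le> ennreal L * seq_norm (orlicz_norm F) (lin_comb I \<alpha> v)"
    if finN: "finite {n\<in>I. \<alpha> n \<noteq> 0}"
      and vw: "\<forall>n\<in>I. finite (supp (v n)) \<and> finite (supp (w n)) \<and> modular (v n) = 1 \<and> modular (w n) \<le> 1"
      and before: "\<forall>m\<in>I. \<forall>n\<in>I. m < n \<longrightarrow>
         set_before (supp (v m) \<union> supp (w m)) (supp (v n) \<union> supp (w n))"
    for I v w and \<alpha> :: "int \<Rightarrow> real"
  proof -
    define N where "N = {n\<in>I. \<alpha> n \<noteq> 0}"
    have fin: "finite (supp (v n))" "finite (supp (w n))" if "n \<in> I" for n using vw that by auto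
    have disj: "supp (v m) \<inter> supp (v n) = {}" "supp (w m) \<inter> supp (w n) = {}"
      if "m \<in> I" "n \<in> I" "m \<noteq> n" for m n
    proof -
      have *: "A \<inter> A' = {} \<and> B \<inter> B' = {}" if "set_before (A \<union> B) (A' \<union> B')" for A A' B B'
        using that by (fastforce simp: set_before_def)
      show "supp (v m) \<inter> supp (v n) = {}" "supp (w m) \<inter> supp (w n) = {}"
        using *[of "supp (v m)" "supp (w m)" "supp (v n)" "supp (w n)"]
          *[of "supp (v n)" "supp (w n)" "supp (v m)" "supp (w m)"] before that
        by (cases "m < n"; auto)+
    qed
    have fin_lc: "finite (supp (lin_comb I \<alpha> v))" "finite (supp (lin_comb I \<alpha> w))"
      using finN fin by (auto intro: finite_supp_lin_comb)
    \<comment> \<open>An arbitrary positive upper bound \<open>a\<close> replaces the norm, which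
      may be 0; letting \<open>a\<close> decrease to the norm gives the claim.\<close>
    have key: "seq_norm (orlicz_norm F) (lin_comb I \<alpha> w) \<le> ennreal (L * a)"
      if a: "0 < a" and na: "seq_norm (orlicz_norm F) (lin_comb I \<alpha> v) \<le> ennreal a" for a
    proof -
      define s where "s n = \<bar>inverse a * \<alpha> n\<bar>" for n
      have s_pos: "0 < s n" if "n \<in> N" for n using that a by (simp add: s_def N_def)
      have mod_lc: "modular (\<lambda>k. inverse a * lin_comb I \<alpha> x k) = (\<Sum>n\<in>N. modular (\<lambda>k. s n * x n k))"
        if "x = v \<or> x = w" for x
      proof -
        have "modular (\<lambda>k. inverse a * lin_comb I \<alpha> x k)
            = (\<Sum>n\<in>N. modular (\<lambda>k. (inverse a * \<alpha> n) * x n k))"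
          unfolding N_def using that finN fin disj by (elim disjE; intro modular_lin_comb; simp)
        also have "\<dots> = (\<Sum>n\<in>N. modular (\<lambda>k. s n * x n k))"
          unfolding s_def using fin that
          by (intro sum.cong refl modular_scale_abs[symmetric]) (auto simp: N_def)
        finally show ?thesis .
      qed
      have "modular (\<lambda>k. inverse a * lin_comb I \<alpha> v k) \<le> 1"
        using na seq_norm_le_iff[OF fin_lc(1) a] by simp
      then have sum_v: "(\<Sum>n\<in>N. modular (\<lambda>k. s n * v n k)) \<le> 1" using mod_lc by simp
      \<comment> \<open>Each \<open>v n\<close> has modular 1, so by convexity a coefficient above 1
        would push the modular of the whole combination above 1.\<close>
      have s_le: "s n \<le> 1" if n: "n \<in> N" for n
      proof (rule ccontr)
        assume *: "\<not> s n \<le> 1"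
        have "s n * modular (v n) \<le> modular (\<lambda>k. s n * v n k)"
          using * n fin by (intro modular_scale_ge) (auto simp: N_def)
        also have "\<dots> \<le> (\<Sum>n\<in>N. modular (\<lambda>k. s n * v n k))"
          using n finN by (intro member_le_sum modular_nonneg) (auto simp: N_def)
        finally show False using sum_v * vw n by (auto simp: N_def)
      qed
      \<comment> \<open>A vanishing \<open>w n\<close> has no range of heights, and it contributes
        nothing to the modular.\<close>
      define N1 where "N1 = {n\<in>N. supp (w n) \<noteq> {}}"
      have N1: "N1 \<subseteq> N" "finite N1"
        using finN by (auto simp: N1_def N_def intro: finite_subset[of _ "{n\<in>I. \<alpha> n \<noteq> 0}"])
      have "\<forall>n\<in>N. \<exists>t. height (Max (supp (v n))) \<le> t \<and> t \<le> height (Min (supp (v n))) \<and>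
          \<phi> t (s n) \<le> 2 * D\<^sup>2 * modular (\<lambda>k. s n * v n k)"
        using vw s_pos by (intro ballI modular_scale_lower) (auto simp: N_def less_imp_le)
      from bchoice[OF this] obtain \<tau> where \<tau>: "\<And>n. n \<in> N \<Longrightarrow> height (Max (supp (v n))) \<le> \<tau> n \<and>
          \<tau> n \<le> height (Min (supp (v n))) \<and> \<phi> (\<tau> n) (s n) \<le> 2 * D\<^sup>2 * modular (\<lambda>k. s n * v n k)"
        by blast
      have "\<forall>n\<in>N1. \<exists>t. height (Max (supp (w n))) \<le> t \<and> t \<le> height (Min (supp (w n))) \<and>
          modular (\<lambda>k. s n * w n k) \<le> 3 * \<phi> t (s n)"
        using vw s_pos by (intro ballI modular_scale_upper) (auto simp: N_def N1_def less_imp_le)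
      from bchoice[OF this] obtain \<tau>' where \<tau>': "\<And>n. n \<in> N1 \<Longrightarrow> height (Max (supp (w n))) \<le> \<tau>' n \<and>
          \<tau>' n \<le> height (Min (supp (w n))) \<and> modular (\<lambda>k. s n * w n k) \<le> 3 * \<phi> (\<tau>' n) (s n)"
        by blast
      have ne: "supp (v n) \<noteq> {}" if "n \<in> N" for n
        using vw that by (fastforce simp: N_def modular_def)
      have c_le: "c \<le> height (Max (supp x))" if "finite (supp x)" "supp x \<noteq> {}" for x
      proof -
        have "Max (supp x) < 0" using that by (auto simp: support_on_def)
        then have "height (- 1) \<le> height (Max (supp x))" by (intro height_antimono) auto
        then show ?thesis by (simp add: c_def)
      qed
      have height_le: "height (Min (supp x)) \<le> height (Max (supp y))"
        if "finite (supp x)" "supp x \<noteq> {}" "finite (supp y)" "supp y \<noteq> {}"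
          "set_before (supp y) (supp x)" for x y
      proof -
        have "Max (supp y) \<in> supp y" "Min (supp x) \<in> supp x" using that by auto
        then have "Max (supp y) < Min (supp x)" using that(5) unfolding set_before_def by blast
        then show ?thesis by (intro height_antimono) auto
      qed
      have "(\<Sum>n\<in>N1. \<phi> (\<tau>' n) (s n)) \<le> M * (1 + (\<Sum>n\<in>N1. \<phi> (\<tau> n) (s n)))"
      proof (rule core)
        show "\<forall>n\<in>N1. 0 < s n \<and> s n \<le> 1 \<and> c \<le> \<tau> n \<and> c \<le> \<tau>' n"
        proof
          fix n assume n: "n \<in> N1"
          then have nN: "n \<in> N" "n \<in> I" "supp (w n) \<noteq> {}" by (auto simp: N1_def N_def)
          show "0 < s n \<and> s n \<le> 1 \<and> c \<le> \<tau> n \<and> c \<le> \<tau>' n"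
            using s_pos[OF nN(1)] s_le[OF nN(1)] \<tau>[OF nN(1)] \<tau>'[OF n]
              c_le[OF fin(1)[OF nN(2)] ne[OF nN(1)]] c_le[OF fin(2)[OF nN(2)] nN(3)] by linarith
        qed
        \<comment> \<open>Later pairs lie further to the right and so have smaller heights: the
          order is reversed.\<close>
        show "\<forall>m\<in>N1. \<forall>n\<in>N1. m < n \<longrightarrow> max (\<tau> n) (\<tau>' n) \<le> min (\<tau> m) (\<tau>' m)"
        proof (intro ballI impI)
          fix m n assume mn: "m \<in> N1" "n \<in> N1" "m < n"
          then have mnN: "m \<in> N" "n \<in> N" "m \<in> I" "n \<in> I" "supp (w m) \<noteq> {}" "supp (w n) \<noteq> {}"
            by (auto simp: N1_def N_def)
          have sb: "set_before (supp (v m) \<union> supp (w m)) (supp (v n) \<union> supp (w n))"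
            using before mnN mn(3) by blast
          have le: "height (Min (supp x)) \<le> height (Max (supp y))"
            if "x = v n \<or> x = w n" "y = v m \<or> y = w m" for x y
            using that sb mnN fin ne by (intro height_le) (auto simp: set_before_def)
          show "max (\<tau> n) (\<tau>' n) \<le> min (\<tau> m) (\<tau>' m)"
            using \<tau>[OF mnN(1)] \<tau>[OF mnN(2)] \<tau>'[OF mn(1)] \<tau>'[OF mn(2)]
              le[of "v n" "v m"] le[of "v n" "w m"] le[of "w n" "v m"] le[of "w n" "w m"] by auto
        qed
      qed (rule N1(2))
      also have "\<dots> \<le> M * (1 + 2 * D\<^sup>2 * 1)"
      proof (intro mult_left_mono add_left_mono)
        have "(\<Sum>n\<in>N1. \<phi> (\<tau> n) (s n)) \<le> (\<Sum>n\<in>N1. 2 * D\<^sup>2 * modular (\<lambda>k. s n * v n k))"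
          using \<tau> N1 by (intro sum_mono) auto
        also have "\<dots> = 2 * D\<^sup>2 * (\<Sum>n\<in>N1. modular (\<lambda>k. s n * v n k))" by (simp add: sum_distrib_left)
        also have "\<dots> \<le> 2 * D\<^sup>2 * 1"
        proof (rule mult_left_mono)
          have "(\<Sum>n\<in>N1. modular (\<lambda>k. s n * v n k)) \<le> (\<Sum>n\<in>N. modular (\<lambda>k. s n * v n k))"
            using finN N1 by (intro sum_mono2 modular_nonneg) (auto simp: N_def)
          then show "(\<Sum>n\<in>N1. modular (\<lambda>k. s n * v n k)) \<le> 1" using sum_v by linarith
        qed auto
        finally show "(\<Sum>n\<in>N1. \<phi> (\<tau> n) (s n)) \<le> 2 * D\<^sup>2 * 1" .
      qed (use M in auto)
      finally have sum_\<tau>': "(\<Sum>n\<in>N1. \<phi> (\<tau>' n) (s n)) \<le> M * (1 + 2 * D\<^sup>2)" by simp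
      have "modular (\<lambda>k. inverse a * lin_comb I \<alpha> w k) = (\<Sum>n\<in>N. modular (\<lambda>k. s n * w n k))"
        using mod_lc by simp
      also have "\<dots> = (\<Sum>n\<in>N1. modular (\<lambda>k. s n * w n k))"
        using finN by (intro sum.mono_neutral_right)
          (auto simp: N1_def N_def modular_scale)
      also have "\<dots> \<le> (\<Sum>n\<in>N1. 3 * \<phi> (\<tau>' n) (s n))" using \<tau>' by (intro sum_mono) auto
      also have "\<dots> = 3 * (\<Sum>n\<in>N1. \<phi> (\<tau>' n) (s n))" by (simp add: sum_distrib_left)
      also have "\<dots> \<le> L" using sum_\<tau>' L(2) by linarith
      finally have le_L: "modular (\<lambda>k. inverse a * lin_comb I \<alpha> w k) \<le> L" .
      have "modular (\<lambda>k. inverse (L * a) * lin_comb I \<alpha> w k)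
          = modular (\<lambda>k. inverse L * (inverse a * lin_comb I \<alpha> w k))" by (simp add: mult.assoc)
      also have "\<dots> \<le> inverse L * modular (\<lambda>k. inverse a * lin_comb I \<alpha> w k)"
        using fin_lc L a supp_scale[of "inverse a" "lin_comb I \<alpha> w"]
        by (intro modular_scale_le) (simp_all add: inverse_le_1_iff)
      also have "\<dots> \<le> inverse L * L" using le_L L by (intro mult_left_mono) auto
      also have "\<dots> = 1" using L by simp
      finally show ?thesis using seq_norm_le_iff[OF fin_lc(2), of "L * a"] L a by simp
    qed
    show ?thesis
    proof (cases "seq_norm (orlicz_norm F) (lin_comb I \<alpha> v)" rule: ennreal_cases)
      case (real b)
      have "seq_norm (orlicz_norm F) (lin_comb I \<alpha> w) \<le> ennreal (L * b)"
      proof (rule ennreal_le_epsilon)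
        fix e :: real assume e: "0 < e"
        have "seq_norm (orlicz_norm F) (lin_comb I \<alpha> w) \<le> ennreal (L * (b + e / L))"
          using real e L by (intro key) (auto intro!: add_nonneg_pos ennreal_leI)
        also have "L * (b + e / L) = L * b + e" using L by (simp add: field_simps)
        also have "ennreal (L * b + e) = ennreal (L * b) + ennreal e"
          using real L e by (intro ennreal_plus) auto
        finally show "seq_norm (orlicz_norm F) (lin_comb I \<alpha> w) \<le> ennreal (L * b) + ennreal e" .
      qed
      then show ?thesis using real L by (simp add: ennreal_mult)
    next
      case top
      then show ?thesis using L by (simp add: ennreal_mult_top)
    qed
  qed
  have "0 < L" using L by simp
  then show thesis using bound by (rule that)
qed

lemma stretchable_if_elastic:
  assumes "elastic_at_infinity F" shows "stretchable (orlicz_norm F)"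
proof -
  obtain M where M: "M > 0" and dom: "\<And>I v w \<alpha>. finite {n\<in>I. \<alpha> n \<noteq> 0} \<Longrightarrow>
    \<forall>n\<in>I. finite (supp (v n)) \<and> finite (supp (w n)) \<and> modular (v n) = 1 \<and> modular (w n) \<le> 1 \<Longrightarrow>
    \<forall>m\<in>I. \<forall>n\<in>I. m < n \<longrightarrow>
       set_before (supp (v m) \<union> supp (w m)) (supp (v n) \<union> supp (w n)) \<Longrightarrow>
    seq_norm (orlicz_norm F) (lin_comb I \<alpha> w)
      \<le> ennreal M * seq_norm (orlicz_norm F) (lin_comb I \<alpha> v)"
    using elastic_domination[OF assms] by blast
  show ?thesis unfolding stretchable_def
  proof (intro exI[of _ M] conjI allI impI, fact M, elim conjE)
    fix I x y and \<alpha> :: "int \<Rightarrow> real" assume il: "interlaced (orlicz_norm F) I x y"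
      and nrm: "\<forall>n\<in>I. seq_norm (orlicz_norm F) (y n) \<le> seq_norm (orlicz_norm F) (x n) \<and>
        seq_norm (orlicz_norm F) (x n) = 1"
      and fin: "finite {n\<in>I. \<alpha> n \<noteq> 0}"
    show "seq_norm (orlicz_norm F) (lin_comb I \<alpha> y)
        \<le> ennreal M * seq_norm (orlicz_norm F) (lin_comb I \<alpha> x)"
    proof (rule dom[OF fin])
      show "\<forall>n\<in>I. finite (supp (x n)) \<and> finite (supp (y n)) \<and> modular (x n) = 1 \<and> modular (y n) \<le> 1"
      proof
        fix n assume n: "n \<in> I"
        then have "finite (supp (x n))" "finite (supp (y n))" using il by (auto simp: interlaced_def)
        moreover have "seq_norm (orlicz_norm F) (x n) = 1" "seq_norm (orlicz_norm F) (y n) \<le> 1"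
          using nrm n by force+
        ultimately show "finite (supp (x n)) \<and> finite (supp (y n)) \<and> modular (x n) = 1 \<and> modular (y n) \<le> 1"
          by (simp add: seq_norm_eq_1_iff seq_norm_le_1_iff)
      qed
      show "\<forall>m\<in>I. \<forall>n\<in>I. m < n \<longrightarrow>
          set_before (supp (x m) \<union> supp (y m)) (supp (x n) \<union> supp (y n))"
        using il by (simp add: interlaced_def)
    qed
  qed
qed

lemma compressible_if_elastic:
  assumes "elastic_at_infinity F" shows "compressible (orlicz_norm F)"
proof -
  obtain M where M: "M > 0" and dom: "\<And>I v w \<alpha>. finite {n\<in>I. \<alpha> n \<noteq> 0} \<Longrightarrow>
    \<forall>n\<in>I. finite (supp (v n)) \<and> finite (supp (w n)) \<and> modular (v n) = 1 \<and> modular (w n) \<le> 1 \<Longrightarrow>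
    \<forall>m\<in>I. \<forall>n\<in>I. m < n \<longrightarrow>
       set_before (supp (v m) \<union> supp (w m)) (supp (v n) \<union> supp (w n)) \<Longrightarrow>
    seq_norm (orlicz_norm F) (lin_comb I \<alpha> w)
      \<le> ennreal M * seq_norm (orlicz_norm F) (lin_comb I \<alpha> v)"
    using elastic_domination[OF assms] by blast
  show ?thesis unfolding compressible_def
  proof (intro exI[of _ M] conjI allI impI, fact M, elim conjE)
    fix I x y and \<alpha> :: "int \<Rightarrow> real" assume il: "interlaced (orlicz_norm F) I x y"
      and nrm: "\<forall>n\<in>I. seq_norm (orlicz_norm F) (x n) \<le> seq_norm (orlicz_norm F) (y n) \<and>
        seq_norm (orlicz_norm F) (y n) = 1"
      and fin: "finite {n\<in>I. \<alpha> n \<noteq> 0}"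
    show "seq_norm (orlicz_norm F) (lin_comb I \<alpha> x)
        \<le> ennreal M * seq_norm (orlicz_norm F) (lin_comb I \<alpha> y)"
    proof (rule dom[OF fin])
      show "\<forall>n\<in>I. finite (supp (y n)) \<and> finite (supp (x n)) \<and> modular (y n) = 1 \<and> modular (x n) \<le> 1"
      proof
        fix n assume n: "n \<in> I"
        then have "finite (supp (x n))" "finite (supp (y n))" using il by (auto simp: interlaced_def)
        moreover have "seq_norm (orlicz_norm F) (y n) = 1" "seq_norm (orlicz_norm F) (x n) \<le> 1"
          using nrm n by force+
        ultimately show "finite (supp (y n)) \<and> finite (supp (x n)) \<and> modular (y n) = 1 \<and> modular (x n) \<le> 1"
          by (simp add: seq_norm_eq_1_iff seq_norm_le_1_iff)
      qed
      show "\<forall>m\<in>I. \<forall>n\<in>I. m < n \<longrightarrow>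
          set_before (supp (y m) \<union> supp (x m)) (supp (y n) \<union> supp (x n))"
        using il by (simp add: interlaced_def Un_commute)
    qed
  qed
qed

end

section \<open>Elasticity from a shift property\<close>

text \<open>Terms are added until the sum reaches 1/2; as each is at most 1/2, it cannot jump beyond
  1.\<close>

lemma greedy_subset:
  fixes f :: "'a \<Rightarrow> real"
  assumes "finite K" "\<And>k. k \<in> K \<Longrightarrow> 0 \<le> f k" "\<And>k. k \<in> K \<Longrightarrow> f k \<le> 1 / 2"
  shows "\<exists>S\<subseteq>K. sum f S \<le> 1 \<and> (S = K \<or> 1 / 2 \<le> sum f S)"
  using assms
proof (induction K rule: finite_induct)
  case (insert k K)
  then obtain S where S: "S \<subseteq> K" "sum f S \<le> 1" "S = K \<or> 1 / 2 \<le> sum f S" by auto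
  show ?case
  proof (cases "1 / 2 \<le> sum f S")
    case True
    then show ?thesis using S by (intro exI[of _ S]) auto
  next
    case False
    then have "S = K" "sum f (insert k S) = f k + sum f S" using S insert.hyps by auto
    moreover have "f k \<le> 1 / 2" using insert.prems by auto
    ultimately show ?thesis using False by (intro exI[of _ "insert k K"]) auto
  qed
qed auto

text \<open>With \<open>u\<close> and \<open>v\<close> the values at left and right endpoints, the
  rises over the intervals are the total displacement plus the falls over the gaps between
  them.\<close>

lemma sum_telescope_intervals:
  fixes u v :: "nat \<Rightarrow> real"
  shows "(\<Sum>k=1..Suc n. v k - u k) = v (Suc n) - u 1 + (\<Sum>k\<in>{1..<Suc n}. v k - u (Suc k))"
proof (induction n)
  case (Suc n)
  have "{1..<Suc (Suc n)} = insert (Suc n) {1..<Suc n}" by auto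
  then show ?case using Suc by simp
qed simp

text \<open>The rises of \<open>g\<close> telescope, so what exceeds its range must be undone between them, and few of
  these gaps carry a fall larger than \<open>L\<close>.\<close>

lemma card_rises_le:
  fixes g :: "real \<Rightarrow> real"
  assumes osc: "\<And>s t. 1 \<le> s \<Longrightarrow> 1 \<le> t \<Longrightarrow> g s - g t \<le> R"
    and L: "0 < L"
    and falls: "\<And>Q. separated 1 Q \<Longrightarrow> (\<And>p. p \<in> Q \<Longrightarrow> L \<le> g (fst p) - g (snd p)) \<Longrightarrow> real (card Q) \<le> N"
    and P: "separated 1 P" "\<And>p. p \<in> P \<Longrightarrow> 2 * L \<le> g (snd p) - g (fst p)"
  shows "real (card P) * L \<le> (N + 1) * R"
proof -
  have R: "0 \<le> R" using osc[of 1 1] by simp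
  have N: "0 \<le> N" using falls[of "{}"] by (simp add: separated_def)
  obtain a b where ab: "interval_chain (card P) a b" "(\<lambda>k. (a k, b k)) ` {1..card P} = P"
    using interval_chain_of_separated[OF P(1)] by auto
  show ?thesis
  proof (cases "card P")
    case 0
    then show ?thesis using R N by simp
  next
    case (Suc n)
    note ch = ab(1)[unfolded Suc] and im = ab(2)[unfolded Suc]
    have rise: "2 * L \<le> g (b k) - g (a k)" if "k \<in> {1..Suc n}" for k
    proof -
      have "(a k, b k) \<in> P" using im that by blast
      from P(2)[OF this] show ?thesis by simp
    qed
    have a1: "1 \<le> a k" "a k < b k" "1 \<le> b k" if "k \<in> {1..Suc n}" for k
      using interval_chain_ge_one[OF ch that] interval_chain_less[OF ch that] by auto
    have ba: "b k \<le> a l" if "1 \<le> k" "k < l" "l \<le> Suc n" for k l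
      using interval_chain_le[OF ch] that by auto
    \<comment> \<open>The gaps with a fall of at least \<open>L\<close>; they form a separated
      family, so \<open>falls\<close> bounds their number.\<close>
    define J where "J = {k\<in>{1..<Suc n}. L \<le> g (b k) - g (a (Suc k))}"
    define Q where "Q = (\<lambda>k. (b k, a (Suc k))) ` J"
    have J: "finite J" "\<And>k. k \<in> J \<Longrightarrow> 1 \<le> k \<and> k \<le> n \<and> L \<le> g (b k) - g (a (Suc k))"
      by (auto simp: J_def)
    have lt: "b k < a (Suc k)" if "k \<in> J" for k
    proof -
      have "b k \<le> a (Suc k)" using J(2)[OF that] by (intro ba) auto
      moreover have "b k \<noteq> a (Suc k)" using J(2)[OF that] L by auto
      ultimately show ?thesis by simp
    qed
    have sep: "a (Suc k) < b l" if "k \<in> J" "l \<in> J" "k < l" for k l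
    proof (cases "Suc k = l")
      case True
      then show ?thesis using a1[of l] J(2)[OF that(2)] by auto
    next
      case False
      have "a (Suc k) < b (Suc k)" using a1[of "Suc k"] J(2)[OF that(1)] by auto
      also have "\<dots> \<le> a l" using False that J(2)[OF that(2)] by (intro ba) auto
      also have "\<dots> < b l" using a1[of l] J(2)[OF that(2)] by auto
      finally show ?thesis .
    qed
    have inj: "inj_on (\<lambda>k. (b k, a (Suc k))) J"
    proof (rule inj_onI, rule ccontr)
      fix k l assume *: "k \<in> J" "l \<in> J" "(b k, a (Suc k)) = (b l, a (Suc l))" "k \<noteq> l"
      then have "a (Suc k) < b l \<or> a (Suc l) < b k" using sep[of k l] sep[of l k] by linarith
      then show False using * lt[of k] lt[of l] by auto
    qed
    have "separated 1 Q"
      unfolding separated_def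
    proof (intro conjI ballI impI)
      show "finite Q" using J by (simp add: Q_def)
      show "1 \<le> fst p" "fst p < snd p" if pQ: "p \<in> Q" for p
      proof -
        obtain k where "k \<in> J" "p = (b k, a (Suc k))" using pQ by (auto simp: Q_def)
        then show "1 \<le> fst p" "fst p < snd p" using lt[of k] a1(3)[of k] J(2)[of k] by auto
      qed
      fix p q assume "p \<in> Q" "q \<in> Q" "p \<noteq> q"
      then obtain k l where "k \<in> J" "l \<in> J" "k \<noteq> l" "p = (b k, a (Suc k))" "q = (b l, a (Suc l))"
        by (auto simp: Q_def)
      then show "snd p \<le> fst q \<or> snd q \<le> fst p"
        using sep[of k l] sep[of l k] by (cases "k < l") (auto intro: less_imp_le)
    qed
    then have "real (card Q) \<le> N" by (rule falls) (use J in \<open>auto simp: Q_def\<close>)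
    then have cardJ: "real (card J) \<le> N" by (simp add: Q_def card_image[OF inj])
    \<comment> \<open>Each of the n + 1 rises is at least 2 L. A gap outside \<open>J\<close> gives
      back at most L and one inside at most R, so a surplus of L per rise is paid by (N + 1)
      R.\<close>
    have "2 * L * real (Suc n) \<le> (\<Sum>k=1..Suc n. g (b k) - g (a k))"
      using sum_bounded_below[of "{1..Suc n}" "2 * L" "\<lambda>k. g (b k) - g (a k)"] rise
      by (simp add: mult.commute)
    also have "\<dots> = g (b (Suc n)) - g (a 1) + (\<Sum>k\<in>{1..<Suc n}. g (b k) - g (a (Suc k)))"
      by (rule sum_telescope_intervals)
    also have "g (b (Suc n)) - g (a 1) \<le> R" using a1 by (intro osc) auto
    also have "(\<Sum>k\<in>{1..<Suc n}. g (b k) - g (a (Suc k)))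
        = (\<Sum>k\<in>{1..<Suc n} - J. g (b k) - g (a (Suc k))) + (\<Sum>k\<in>J. g (b k) - g (a (Suc k)))"
      by (intro sum.subset_diff) (auto simp: J_def)
    also have "(\<Sum>k\<in>{1..<Suc n} - J. g (b k) - g (a (Suc k))) \<le> (\<Sum>k\<in>{1..<Suc n} - J. L)"
      by (intro sum_mono) (auto simp: J_def)
    also have "\<dots> \<le> (\<Sum>k\<in>{1..<Suc n}. L)" using L by (intro sum_mono2) auto
    also have "\<dots> = n * L" by simp
    also have "(\<Sum>k\<in>J. g (b k) - g (a (Suc k))) \<le> (\<Sum>k\<in>J. R)"
    proof (rule sum_mono)
      fix k assume "k \<in> J"
      then show "g (b k) - g (a (Suc k)) \<le> R"
        using J(2)[of k] a1(3)[of k] a1(1)[of "Suc k"] by (intro osc) auto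
    qed
    also have "\<dots> \<le> N * R" using cardJ R by (simp add: mult_right_mono)
    finally have "2 * L * real (Suc n) \<le> R + (n * L + N * R)" by simp
    then have "L * (n + 2) \<le> (N + 1) * R" by (simp add: algebra_simps)
    moreover have "real (card P) * L \<le> L * (n + 2)" using Suc L by (simp add: algebra_simps)
    ultimately show ?thesis by linarith
  qed
qed

section \<open>Unit vectors as test families for the shift properties\<close>

context orlicz_delta2
begin

definition unit_vector :: "int \<Rightarrow> int \<Rightarrow> real" where
  "unit_vector k j = (if j = k then height k else 0)"

lemma supp_unit_vector: "k < 0 \<Longrightarrow> supp (unit_vector k) = {k}"
  using height_pos[of k] by (auto simp: support_on_def unit_vector_def)

lemma modular_unit_vector: "k < 0 \<Longrightarrow> modular (\<lambda>j. s * unit_vector k j) = \<phi> (height k) \<bar>s\<bar>"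
  using height_pos[of k] by (simp add: modular_scale supp_unit_vector)
    (simp add: unit_vector_def dilate_def F_height power_int_minus divide_inverse mult.commute)

lemma seq_norm_unit_vector: "k < 0 \<Longrightarrow> seq_norm (orlicz_norm F) (unit_vector k) = 1"
  using modular_unit_vector[of k 1] height_pos[of k]
  by (simp add: seq_norm_eq_1_iff supp_unit_vector dilate_def F_height)

text \<open>Heights decrease with the position, so the intervals from \<open>height (h i)\<close> to
  \<open>height (l i)\<close> move upwards as \<open>i\<close> grows.\<close>

definition interlaced_indices :: "nat \<Rightarrow> (nat \<Rightarrow> int) \<Rightarrow> (nat \<Rightarrow> int) \<Rightarrow> bool" where
  "interlaced_indices m l h \<longleftrightarrow> (\<forall>i\<in>{1..m}. l i < h i \<and> h i < 0) \<and>
     (\<forall>i\<in>{1..m}. \<forall>j\<in>{1..m}. i < j \<longrightarrow> h j < l i)"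

text \<open>A shift property in modular form, tested on unit vectors with equal coefficients
  \<open>s\<close> over a subfamily. \<open>d\<close> selects the direction: True is the right
  shift, from the low positions \<open>l\<close> to the high positions \<open>h\<close>.\<close>

definition unit_transfer :: "bool \<Rightarrow> real \<Rightarrow> bool" where
  "unit_transfer d M \<longleftrightarrow> (\<forall>m l h S s. interlaced_indices m l h \<longrightarrow> S \<subseteq> {1..m} \<longrightarrow> 0 < s \<longrightarrow>
     (\<Sum>i\<in>S. \<phi> (height (if d then l i else h i)) s) \<le> 1 \<longrightarrow>
     (\<Sum>i\<in>S. \<phi> (height (if d then h i else l i)) s) \<le> M)"

text \<open>The families of \<^const>\<open>interlaced\<close> run towards index \<open>-1\<close>, that is, towards small heights,
  whereas our chains run towards large ones; hence the index \<open>n = - i\<close>.\<close>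

abbreviation unit_family :: "(nat \<Rightarrow> int) \<Rightarrow> int \<Rightarrow> int \<Rightarrow> real" where
  "unit_family k n \<equiv> unit_vector (k (nat (- n)))"

lemma interlaced_unit_family:
  assumes "interlaced_indices m l h"
  shows "interlaced (orlicz_norm F) {- int m..- 1} (unit_family l) (unit_family h)"
proof -
  have nat_mem: "nat (- n) \<in> {1..m}" if "n \<in> {- int m..- 1}" for n using that by auto
  have neg: "l (nat (- n)) < h (nat (- n))" "h (nat (- n)) < 0" "l (nat (- n)) < 0"
    if "n \<in> {- int m..- 1}" for n
  proof -
    show "l (nat (- n)) < h (nat (- n))" "h (nat (- n)) < 0"
      using assms nat_mem[OF that] unfolding interlaced_indices_def by blast+
    then show "l (nat (- n)) < 0" by linarith
  qed
  have ord: "h (nat (- n)) < l (nat (- n'))"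
    if "n \<in> {- int m..- 1}" "n' \<in> {- int m..- 1}" "n < n'" for n n'
  proof -
    have "nat (- n') < nat (- n)" using that by auto
    then show ?thesis
      using assms nat_mem[OF that(1)] nat_mem[OF that(2)] unfolding interlaced_indices_def by blast
  qed
  show ?thesis
    unfolding interlaced_def
  proof (intro conjI ballI allI impI)
    fix n assume n: "n \<in> {- int m..- 1}"
    show "unit_family l n \<in> seq_space (orlicz_norm F)" "unit_family h n \<in> seq_space (orlicz_norm F)"
      "finite (supp (unit_family l n))" "finite (supp (unit_family h n))"
      "set_before (supp (unit_family l n)) (supp (unit_family h n))"
      using neg[OF n] by (auto simp: seq_space_def seq_norm_unit_vector supp_unit_vector set_before_def)
  next
    fix n assume "n \<in> {- int m..- 1} \<and> n + 1 \<in> {- int m..- 1}"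
    then show "set_before (supp (unit_family h n)) (supp (unit_family l (n + 1)))"
      using neg[of n] neg[of "n + 1"] ord[of n "n + 1"] by (auto simp: supp_unit_vector set_before_def)
  next
    fix n n' assume "n \<in> {- int m..- 1}" "n' \<in> {- int m..- 1}" "n < n'"
    then show "set_before (supp (unit_family l n) \<union> supp (unit_family h n))
        (supp (unit_family l n') \<union> supp (unit_family h n'))"
      using neg[of n] neg[of n'] ord[of n n'] by (auto simp: supp_unit_vector set_before_def)
  qed
qed

lemma modular_lin_comb_unit_family:
  assumes k: "\<And>i. i \<in> {1..m} \<Longrightarrow> k i < 0" "inj_on k {1..m}" and S: "S \<subseteq> {1..m}" and s: "0 < s"
  shows "modular (\<lambda>j. c * lin_comb {- int m..- 1} (\<lambda>n. if nat (- n) \<in> S then s else 0) (unit_family k) j)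
    = (\<Sum>i\<in>S. \<phi> (height (k i)) (\<bar>c\<bar> * s))"
proof -
  let ?I = "{- int m..- 1}" and ?\<alpha> = "\<lambda>n. if nat (- n) \<in> S then s else 0"
  have nat_mem: "nat (- n) \<in> {1..m}" if "n \<in> ?I" for n using that by auto
  have I: "{n\<in>?I. ?\<alpha> n \<noteq> 0} = (\<lambda>i. - int i) ` S"
  proof (intro equalityI subsetI)
    fix n assume "n \<in> {n\<in>?I. ?\<alpha> n \<noteq> 0}"
    then have n: "n \<le> - 1" "nat (- n) \<in> S" by (simp_all split: if_splits)
    then have "n = - int (nat (- n))" by simp
    with n(2) show "n \<in> (\<lambda>i. - int i) ` S" by (rule image_eqI[rotated])
  next
    fix n assume "n \<in> (\<lambda>i. - int i) ` S"
    then obtain i where i: "i \<in> S" "n = - int i" by blast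
    then have "1 \<le> i" "i \<le> m" using S by auto
    then show "n \<in> {n\<in>?I. ?\<alpha> n \<noteq> 0}" using i s by simp
  qed
  have "modular (\<lambda>j. c * lin_comb ?I ?\<alpha> (unit_family k) j)
      = (\<Sum>n\<in>{n\<in>?I. ?\<alpha> n \<noteq> 0}. modular (\<lambda>j. (c * ?\<alpha> n) * unit_family k n j))"
  proof (rule modular_lin_comb)
    show "finite {n\<in>?I. ?\<alpha> n \<noteq> 0}" by (rule finite_subset[of _ ?I]) auto
    show "finite (supp (unit_family k n))" if "n \<in> ?I" for n
      using k(1)[OF nat_mem[OF that]] by (simp add: supp_unit_vector)
    fix m' n assume mn: "m' \<in> ?I" "n \<in> ?I" "m' \<noteq> n"
    then have "nat (- m') \<noteq> nat (- n)" by auto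
    then have "k (nat (- m')) \<noteq> k (nat (- n))"
      using k(2) nat_mem[OF mn(1)] nat_mem[OF mn(2)] by (auto dest: inj_onD)
    then show "supp (unit_family k m') \<inter> supp (unit_family k n) = {}"
      using k(1)[OF nat_mem[OF mn(1)]] k(1)[OF nat_mem[OF mn(2)]] by (simp add: supp_unit_vector)
  qed
  also have "\<dots> = (\<Sum>i\<in>S. modular (\<lambda>j. (c * s) * unit_vector (k i) j))"
    unfolding I by (subst sum.reindex) (auto simp: inj_on_def)
  also have "\<dots> = (\<Sum>i\<in>S. \<phi> (height (k i)) (\<bar>c\<bar> * s))"
    using S k(1) s by (intro sum.cong refl) (auto simp: modular_unit_vector abs_mult)
  finally show ?thesis .
qed

lemma interlaced_indices_props:
  assumes "interlaced_indices m l h"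
  shows "\<And>i. i \<in> {1..m} \<Longrightarrow> l i < 0" "\<And>i. i \<in> {1..m} \<Longrightarrow> h i < 0"
    "inj_on l {1..m}" "inj_on h {1..m}"
proof -
  have a: "l i < h i" "h i < 0" if "i \<in> {1..m}" for i
    using assms that by (auto simp: interlaced_indices_def)
  have b: "h j < l i" if "i \<in> {1..m}" "j \<in> {1..m}" "i < j" for i j
    using assms that by (auto simp: interlaced_indices_def)
  show "l i < 0" if "i \<in> {1..m}" for i using a[OF that] by linarith
  show "h i < 0" if "i \<in> {1..m}" for i using a[OF that] by linarith
  have c: "l i \<noteq> l j \<and> h i \<noteq> h j" if "i \<in> {1..m}" "j \<in> {1..m}" "i \<noteq> j" for i j
    using that a[of i] a[of j] b[of i j] b[of j i] by (cases "i < j") auto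
  show "inj_on l {1..m}" "inj_on h {1..m}" using c by (blast intro: inj_onI)+
qed

text \<open>The norm constant, rounded up to \<open>2 ^ q\<close>, becomes the modular constant
  \<open>D ^ q\<close> by \<open>q\<close> doublings.\<close>

lemma transfer_of_norm_bound:
  assumes k: "\<And>i. i \<in> {1..m} \<Longrightarrow> k i < 0" "inj_on k {1..m}"
    and k': "\<And>i. i \<in> {1..m} \<Longrightarrow> k' i < 0" "inj_on k' {1..m}"
    and S: "S \<subseteq> {1..m}" and s: "0 < s"
    and C: "0 < C" "C \<le> 2 ^ q"
    and norm: "\<And>\<alpha>. finite {n\<in>{- int m..- 1}. \<alpha> n \<noteq> 0} \<Longrightarrow>
      seq_norm (orlicz_norm F) (lin_comb {- int m..- 1} \<alpha> (unit_family k'))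
      \<le> ennreal C * seq_norm (orlicz_norm F) (lin_comb {- int m..- 1} \<alpha> (unit_family k))"
    and le1: "(\<Sum>i\<in>S. \<phi> (height (k i)) s) \<le> 1"
  shows "(\<Sum>i\<in>S. \<phi> (height (k' i)) s) \<le> D ^ q"
proof -
  let ?\<alpha> = "\<lambda>n. if nat (- n) \<in> S then s else 0"
  let ?x = "lin_comb {- int m..- 1} ?\<alpha> (unit_family k)"
  let ?y = "lin_comb {- int m..- 1} ?\<alpha> (unit_family k')"
  have fin_unit: "finite (supp (unit_family k n))" "finite (supp (unit_family k' n))"
    if "n \<in> {- int m..- 1}" for n
  proof -
    have "nat (- n) \<in> {1..m}" using that by auto
    then show "finite (supp (unit_family k n))" "finite (supp (unit_family k' n))"
      using k(1) k'(1) by (simp_all add: supp_unit_vector)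
  qed
  have fin_\<alpha>: "finite {n\<in>{- int m..- 1}. ?\<alpha> n \<noteq> 0}"
    by (rule finite_subset[of _ "{- int m..- 1}"]) auto
  have fin: "finite (supp ?x)" "finite (supp ?y)"
    by (intro finite_supp_lin_comb fin_\<alpha> fin_unit; assumption)+
  have "modular ?x \<le> 1"
    using modular_lin_comb_unit_family[OF k S s, of 1] le1 by simp
  then have "seq_norm (orlicz_norm F) ?x \<le> 1" using seq_norm_le_1_iff[OF fin(1)] by simp
  then have "ennreal C * seq_norm (orlicz_norm F) ?x \<le> ennreal C * 1" by (intro mult_left_mono) auto
  also have "ennreal C * 1 \<le> ennreal (2 ^ q)" using C by (simp add: ennreal_leI)
  finally have "seq_norm (orlicz_norm F) ?y \<le> ennreal (2 ^ q)"
    using norm[OF fin_\<alpha>] by (rule order_trans[rotated])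
  then have le: "modular (\<lambda>j. inverse (2 ^ q) * ?y j) \<le> 1"
    using seq_norm_le_iff[OF fin(2), of "2 ^ q"] by simp
  have "2 ^ q * (inverse (2 ^ q) * z) = z" for z :: real by simp
  then have "modular ?y = modular (\<lambda>j. 2 ^ q * (inverse (2 ^ q) * ?y j))" by (simp only:)
  also have "\<dots> \<le> D ^ q * modular (\<lambda>j. inverse (2 ^ q) * ?y j)"
    using fin by (intro modular_pow2_le) (simp add: supp_scale)
  also have "\<dots> \<le> D ^ q * 1" using le D_ge_2 by (intro mult_left_mono) auto
  finally show ?thesis using modular_lin_comb_unit_family[OF k' S s, of 1] by simp
qed

lemma unit_transfer_if_stretchable:
  assumes "stretchable (orlicz_norm F)" shows "\<exists>M. unit_transfer True M"
proof -
  obtain C where C: "C > 0" and str: "\<forall>I x y \<alpha>. int_interval I \<and> interlaced (orlicz_norm F) I x y \<and>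
     (\<forall>n\<in>I. seq_norm (orlicz_norm F) (y n) \<le> seq_norm (orlicz_norm F) (x n) \<and> seq_norm (orlicz_norm F) (x n) = 1) \<and>
     finite {n\<in>I. \<alpha> n \<noteq> 0} \<longrightarrow>
     seq_norm (orlicz_norm F) (lin_comb I \<alpha> y) \<le> ennreal C * seq_norm (orlicz_norm F) (lin_comb I \<alpha> x)"
    using assms unfolding stretchable_def by blast
  obtain q where q: "C \<le> 2 ^ q" using real_arch_pow[of 2 C] by (auto intro: less_imp_le)
  have "unit_transfer True (D ^ q)"
    unfolding unit_transfer_def if_True
  proof (intro allI impI)
    fix m l h S and s :: real
    assume il: "interlaced_indices m l h" and *: "S \<subseteq> {1..m}" "0 < s" "(\<Sum>i\<in>S. \<phi> (height (l i)) s) \<le> 1"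
    note props = interlaced_indices_props[OF il]
    show "(\<Sum>i\<in>S. \<phi> (height (h i)) s) \<le> D ^ q"
    proof (rule transfer_of_norm_bound[OF props(1,3,2,4) *(1,2) C q _ *(3)])
      fix \<alpha> :: "int \<Rightarrow> real" assume fin: "finite {n\<in>{- int m..- 1}. \<alpha> n \<noteq> 0}"
      have "l (nat (- n)) < 0 \<and> h (nat (- n)) < 0" if "n \<in> {- int m..- 1}" for n
      proof -
        have "nat (- n) \<in> {1..m}" using that by auto
        then show ?thesis using props(1,2) by blast
      qed
      then show "seq_norm (orlicz_norm F) (lin_comb {- int m..- 1} \<alpha> (unit_family h))
          \<le> ennreal C * seq_norm (orlicz_norm F) (lin_comb {- int m..- 1} \<alpha> (unit_family l))"
        using interlaced_unit_family[OF il] fin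
        by (intro str[rule_format] conjI) (auto simp: int_interval_def seq_norm_unit_vector)
    qed
  qed
  then show ?thesis by blast
qed

lemma unit_transfer_if_compressible:
  assumes "compressible (orlicz_norm F)" shows "\<exists>M. unit_transfer False M"
proof -
  obtain C where C: "C > 0" and cpr: "\<forall>I x y \<alpha>. int_interval I \<and> interlaced (orlicz_norm F) I x y \<and>
     (\<forall>n\<in>I. seq_norm (orlicz_norm F) (x n) \<le> seq_norm (orlicz_norm F) (y n) \<and> seq_norm (orlicz_norm F) (y n) = 1) \<and>
     finite {n\<in>I. \<alpha> n \<noteq> 0} \<longrightarrow>
     seq_norm (orlicz_norm F) (lin_comb I \<alpha> x) \<le> ennreal C * seq_norm (orlicz_norm F) (lin_comb I \<alpha> y)"
    using assms unfolding compressible_def by blast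
  obtain q where q: "C \<le> 2 ^ q" using real_arch_pow[of 2 C] by (auto intro: less_imp_le)
  have "unit_transfer False (D ^ q)"
    unfolding unit_transfer_def if_False
  proof (intro allI impI)
    fix m l h S and s :: real
    assume il: "interlaced_indices m l h" and *: "S \<subseteq> {1..m}" "0 < s" "(\<Sum>i\<in>S. \<phi> (height (h i)) s) \<le> 1"
    note props = interlaced_indices_props[OF il]
    show "(\<Sum>i\<in>S. \<phi> (height (l i)) s) \<le> D ^ q"
    proof (rule transfer_of_norm_bound[OF props(2,4,1,3) *(1,2) C q _ *(3)])
      fix \<alpha> :: "int \<Rightarrow> real" assume fin: "finite {n\<in>{- int m..- 1}. \<alpha> n \<noteq> 0}"
      have "l (nat (- n)) < 0 \<and> h (nat (- n)) < 0" if "n \<in> {- int m..- 1}" for n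
      proof -
        have "nat (- n) \<in> {1..m}" using that by auto
        then show ?thesis using props(1,2) by blast
      qed
      then show "seq_norm (orlicz_norm F) (lin_comb {- int m..- 1} \<alpha> (unit_family l))
          \<le> ennreal C * seq_norm (orlicz_norm F) (lin_comb {- int m..- 1} \<alpha> (unit_family h))"
        using interlaced_unit_family[OF il] fin
        by (intro cpr[rule_format] conjI) (auto simp: int_interval_def seq_norm_unit_vector)
    qed
  qed
  then show ?thesis by blast
qed

text \<open>The index k with 2^(-k) \<le> F(t) < 2^(-k+1), so that \<open>height k\<close> equals
  \<open>t\<close> up to a factor 2. The cap at -1, active for small \<open>t\<close>, keeps the
  index negative.\<close>

definition idx :: "real \<Rightarrow> int" where
  "idx t = min (- 1) (- \<lfloor>log 2 (F t)\<rfloor>)"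

lemma idx_neg: "idx t < 0"
  by (simp add: idx_def)

lemma idx_antimono: "0 < s \<Longrightarrow> s \<le> t \<Longrightarrow> idx t \<le> idx s"
  using F_pos[of s] F_mono[of s t] unfolding idx_def by (intro min.mono le_imp_neg_le floor_mono log_mono) auto

text \<open>Where the cap is inactive, \<open>t\<close> lies between the height and its double;
  otherwise it lies between 1 and \<open>height (- 1)\<close>, a bounded range. One exponent
  \<open>q\<close> serves both cases through \<open>\<phi>_comparable\<close>.\<close>

lemma idx_comparable:
  obtains q where "\<And>t s. 1 \<le> t \<Longrightarrow> 0 \<le> s \<Longrightarrow> \<phi> (height (idx t)) s \<le> D ^ q * \<phi> t s"
    "\<And>t s. 1 \<le> t \<Longrightarrow> 0 \<le> s \<Longrightarrow> \<phi> t s \<le> D ^ q * \<phi> (height (idx t)) s"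
proof -
  obtain q0 where q0: "height (- 1) < 2 ^ q0" using real_arch_pow[of 2 "height (- 1)"] by auto
  define q where "q = Suc q0"
  have "(1::real) \<le> 2 ^ q0" by simp
  then have q: "height (- 1) \<le> 2 ^ q" "2 \<le> (2::real) ^ q"
    using q0 unfolding q_def power_Suc by linarith+
  have "\<phi> (height (idx t)) s \<le> D ^ q * \<phi> t s \<and> \<phi> t s \<le> D ^ q * \<phi> (height (idx t)) s"
    if t: "1 \<le> t" and s: "0 \<le> s" for t s
  proof (cases "1 \<le> \<lfloor>log 2 (F t)\<rfloor>")
    case True
    define k where "k = idx t"
    have k: "- k = \<lfloor>log 2 (F t)\<rfloor>" using True by (simp add: k_def idx_def)
    have Ft: "0 < F t" using t by (intro F_pos) auto
    have "real_of_int (- k) \<le> log 2 (F t)" "log 2 (F t) \<le> real_of_int (- k + 1)"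
      unfolding k by linarith+
    then have "2 powr real_of_int (- k) \<le> F t" "F t \<le> 2 powr real_of_int (- k + 1)"
      using Ft by (auto simp only: le_log_iff log_le_iff one_less_numeral_iff semiring_norm)
    moreover have "2 powr real_of_int i = 2 powi i" for i by (simp add: powr_real_of_int')
    ultimately have "2 powi (- k) \<le> F t" "F t \<le> 2 powi (- k + 1)" by (simp_all only:)
    moreover have "2 powi (- k + 1) = 2 * (2 powi (- k) :: real)" by (subst power_int_add) auto
    ultimately have "F (height k) \<le> F t" "F t \<le> 2 * F (height k)" by (simp_all only: F_height)
    moreover have "2 * F (height k) \<le> F (2 * height k)" using height_pos[of k] by (intro F_mult_ge) auto
    ultimately have "height k \<le> t" "t \<le> 2 * height k"
      using F_le_iff[of "height k" t] F_le_iff[of t "2 * height k"] height_pos[of k] t by auto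
    moreover from this have "t \<le> 2 ^ q * height k"
      using mult_right_mono[OF q(2), of "height k"] height_pos[of k] by linarith
    ultimately show ?thesis
      using \<phi>_comparable[of "height k" t q s] height_pos[of k] s by (simp add: k_def)
  next
    case False
    then have "idx t = - 1" by (simp add: idx_def)
    have "log 2 (F t) < 1" using False by linarith
    then have "F t \<le> 2" using F_pos[of t] t log_less_iff[of 2 "F t" 1] by simp
    then have "F t \<le> F (height (- 1))" by (simp add: F_height)
    then have "t \<le> height (- 1)" using F_le_iff[of t "height (- 1)"] height_pos[of "- 1"] t by simp
    moreover have "2 ^ q * 1 \<le> 2 ^ q * t" using t by (intro mult_left_mono) auto
    then have "height (- 1) \<le> 2 ^ q * t" using q(1) by linarith
    ultimately show ?thesis
      using \<phi>_comparable[of t "height (- 1)" q s] t s \<open>idx t = - 1\<close> by simp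
  qed
  then show thesis by (intro that[of q]) auto
qed

text \<open>Only every other interval of a chain is used: the discretizations of adjacent endpoints
  \<open>b k \<le> a (Suc k)\<close> may coincide, whereas \<^const>\<open>interlaced\<close> needs strict separation.\<close>

lemma card_le_of_unit_transfer:
  assumes tr: "unit_transfer d M"
  obtains C K where "C > 1" "K > 0" "\<And>x P. 0 < x \<Longrightarrow> x \<le> 1 \<Longrightarrow> separated 1 P \<Longrightarrow>
    \<forall>p\<in>P. if d then C * \<phi> (snd p) x \<le> \<phi> (fst p) x else C * \<phi> (fst p) x \<le> \<phi> (snd p) x \<Longrightarrow>
    real (card P) \<le> K * x powr (- log 2 D)"
proof -
  obtain q where q: "\<And>t s. 1 \<le> t \<Longrightarrow> 0 \<le> s \<Longrightarrow>
     \<phi> (height (idx t)) s \<le> D ^ q * \<phi> t s" "\<And>t s. 1 \<le> t \<Longrightarrow> 0 \<le> s \<Longrightarrow> \<phi> t s \<le> D ^ q * \<phi> (height (idx t)) s"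
    using idx_comparable by blast
  \<comment> \<open>\<open>E\<close> exceeds \<open>D\<close> to settle x > 1/2, exceeds 1 to keep
    rounded endpoints distinct, and exceeds 2 M to contradict the transfer.\<close>
  define E where "E = 2 * max D M + 1"
  \<comment> \<open>Both endpoints are rounded, each at the price of \<open>D ^ q\<close>.\<close>
  define C where "C = D ^ q * E * D ^ q"
  have Dq: "1 \<le> D ^ q" using D_ge_2 by simp
  have E: "D < E" "1 < E" "M < E / 2" using D_ge_2 by (auto simp: E_def)
  have "1 * E * 1 \<le> C" unfolding C_def using Dq E by (intro mult_mono) auto
  then have C: "D < C" "1 < C" using E by auto
  have bound: "real (card P) \<le> (2 * D + 1) * x powr (- log 2 D)"
    if x: "0 < x" "x \<le> 1" and P: "separated 1 P"
      and osc: "\<forall>p\<in>P. if d then C * \<phi> (snd p) x \<le> \<phi> (fst p) x else C * \<phi> (fst p) x \<le> \<phi> (snd p) x"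
    for x P
  proof (cases "x \<le> 1 / 2")
    case False
    \<comment> \<open>For x > 1/2 all values of \<open>\<phi>\<close> lie between 1/D and 1, so no
      change by the factor \<open>C\<close> > \<open>D\<close> can occur.\<close>
    have large: "1 / D \<le> \<phi> t x" if "0 < t" for t
    proof -
      have "1 = \<phi> t (2 ^ 1 * (1 / 2))" using F_pos[OF that] by (simp add: dilate_def)
      also have "\<dots> \<le> D ^ 1 * \<phi> t (1 / 2)" using that by (intro \<phi>_pow2_le) auto
      also have "\<dots> \<le> D ^ 1 * \<phi> t x" using that False D_ge_2 by (intro mult_left_mono \<phi>_mono) auto
      finally show ?thesis using D_ge_2 by (simp add: field_simps)
    qed
    have "P = {}"
    proof (rule ccontr)
      assume "P \<noteq> {}"
      then obtain p where p: "p \<in> P" by auto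
      then have pos: "0 < fst p" "0 < snd p" using P by (fastforce simp: separated_def)+
      have "1 < C * (1 / D)" using C D_ge_2 by simp
      also have "C * (1 / D) \<le> C * \<phi> (fst p) x" "C * (1 / D) \<le> C * \<phi> (snd p) x"
        using large pos C by (auto intro!: mult_left_mono simp del: times_divide_eq_right)
      ultimately have "1 < C * \<phi> (fst p) x" "1 < C * \<phi> (snd p) x" by auto
      moreover have "\<phi> (fst p) x \<le> 1" "\<phi> (snd p) x \<le> 1"
        using \<phi>_le[of "fst p" x] \<phi>_le[of "snd p" x] pos x by auto
      ultimately show False using osc p by (auto split: if_splits)
    qed
    then show ?thesis using D_ge_2 by simp
  next
    case True
    define n where "n = card P"
    obtain a b where ab: "interval_chain n a b" "(\<lambda>k. (a k, b k)) ` {1..n} = P"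
      using interval_chain_of_separated[OF P] by (auto simp: n_def)
    have a1: "1 \<le> a k" "a k < b k" "1 \<le> b k" if "k \<in> {1..n}" for k
      using interval_chain_ge_one[OF ab(1) that] interval_chain_less[OF ab(1) that] by auto
    \<comment> \<open>\<open>f\<close> belongs to the endpoint with the small value of
      \<open>\<phi>\<close>, \<open>g\<close> to the one with the large value.\<close>
    define f where "f k = \<phi> (height (if d then idx (b k) else idx (a k))) x" for k
    define g where "g k = \<phi> (height (if d then idx (a k) else idx (b k))) x" for k
    have f_pos: "0 < f k" for k unfolding f_def using height_pos x by (intro \<phi>_pos) auto
    have f_le: "f k \<le> 1 / 2" for k
      unfolding f_def using True x by (intro order_trans[OF \<phi>_le] height_pos) auto
    have fg: "E * f k \<le> g k" if k: "k \<in> {1..n}" for k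
    proof -
      have "(a k, b k) \<in> P" using ab(2) k by blast
      then have o: "if d then C * \<phi> (b k) x \<le> \<phi> (a k) x else C * \<phi> (a k) x \<le> \<phi> (b k) x"
        using osc by fastforce
      define u v where "u = (if d then b k else a k)" and "v = (if d then a k else b k)"
      have uv: "1 \<le> u" "1 \<le> v" "C * \<phi> u x \<le> \<phi> v x" using o a1[OF k] by (auto simp: u_def v_def)
      have "f k = \<phi> (height (idx u)) x" "g k = \<phi> (height (idx v)) x"
        by (auto simp: f_def g_def u_def v_def)
      then have *: "f k \<le> D ^ q * \<phi> u x" "\<phi> v x \<le> D ^ q * g k" using q uv x by auto
      have "D ^ q * (E * f k) \<le> D ^ q * (E * (D ^ q * \<phi> u x))"
        using * E Dq by (intro mult_left_mono) auto
      also have "\<dots> = C * \<phi> u x" by (simp add: C_def)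
      also have "\<dots> \<le> D ^ q * g k" using uv * by linarith
      finally show ?thesis using Dq by simp
    qed
    have strict: "idx (b k) < idx (a k)" if k: "k \<in> {1..n}" for k
    proof -
      have "f k < E * f k" using f_pos E by simp
      then have "f k \<noteq> g k" using fg[OF k] by auto
      moreover have "f k = g k" if "idx (b k) = idx (a k)" by (simp add: f_def g_def that)
      ultimately have "idx (b k) \<noteq> idx (a k)" by blast
      moreover have "idx (b k) \<le> idx (a k)" using a1[OF k] by (intro idx_antimono) auto
      ultimately show ?thesis by simp
    qed
    define m where "m = n div 2"
    define l where "l i = idx (b (2 * i))" for i
    define h where "h i = idx (a (2 * i))" for i
    have even: "2 * i \<in> {1..n}" if "i \<in> {1..m}" for i using that by (auto simp: m_def)
    have il: "interlaced_indices m l h"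
      unfolding interlaced_indices_def
    proof (intro conjI ballI impI)
      fix i assume i: "i \<in> {1..m}"
      show "l i < h i" "h i < 0" using strict[OF even[OF i]] idx_neg by (auto simp: l_def h_def)
      fix j assume j: "j \<in> {1..m}" "i < j"
      then have mem: "2 * i + 1 \<in> {1..n}" "2 * i + 1 < 2 * j" "2 * j \<le> n" using even[of j] by auto
      have "idx (a (2 * j)) \<le> idx (b (2 * i + 1))"
        using a1[OF mem(1)] mem by (intro idx_antimono interval_chain_le[OF ab(1)]) auto
      also have "\<dots> < idx (a (2 * i + 1))" by (rule strict[OF mem(1)])
      also have "\<dots> \<le> idx (b (2 * i))"
        using a1[OF even[OF i]] mem i by (intro idx_antimono interval_chain_le[OF ab(1)]) auto
      finally show "h j < l i" by (simp add: l_def h_def)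
    qed
    \<comment> \<open>If \<open>S\<close> were stopped early, its sum of \<open>f\<close> would be
      at least 1/2 and its sum of \<open>g\<close> at least E/2, which is above \<open>M\<close>. So
      \<open>S\<close> is the whole family, and the \<open>m\<close> values of \<open>f\<close>,
      each at least x^(log_2 D)/D, sum to at most 1.\<close>
    obtain S where S: "S \<subseteq> {1..m}" "(\<Sum>i\<in>S. f (2 * i)) \<le> 1"
      "S = {1..m} \<or> 1 / 2 \<le> (\<Sum>i\<in>S. f (2 * i))"
      using greedy_subset[of "{1..m}" "\<lambda>i. f (2 * i)"] f_pos f_le by (auto simp: less_imp_le)
    have "(\<Sum>i\<in>S. g (2 * i)) \<le> M"
      using tr[unfolded unit_transfer_def, rule_format, OF il S(1) x(1)] S(2)
      unfolding f_def g_def l_def h_def by simp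
    moreover have "E * (\<Sum>i\<in>S. f (2 * i)) \<le> (\<Sum>i\<in>S. g (2 * i))"
      unfolding sum_distrib_left using S(1) even by (intro sum_mono fg) auto
    ultimately have "E * (\<Sum>i\<in>S. f (2 * i)) < E * (1 / 2)" using E by linarith
    then have "(\<Sum>i\<in>S. f (2 * i)) < 1 / 2" using E by simp
    then have "(\<Sum>i\<in>{1..m}. f (2 * i)) \<le> 1" using S by auto
    moreover have "x powr log 2 D / D \<le> f i" for i
      unfolding f_def using x by (intro \<phi>_lower_bound height_pos)
    then have "real m * (x powr log 2 D / D) \<le> (\<Sum>i\<in>{1..m}. f (2 * i))"
      using sum_bounded_below[of "{1..m}" "x powr log 2 D / D" "\<lambda>i. f (2 * i)"] by simp
    ultimately have "real m * (x powr log 2 D / D) \<le> 1" by linarith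
    then have "real m \<le> D * x powr (- log 2 D)" using x D_ge_2 by (simp add: powr_minus field_simps)
    moreover have "1 \<le> x powr (- log 2 D)"
      using x D_ge_2 powr_le1[of "log 2 D" x] by (simp add: powr_minus field_simps)
    moreover have "real n \<le> 2 * real m + 1" unfolding m_def by linarith
    ultimately show ?thesis by (simp add: n_def algebra_simps)
  qed
  have "0 < 2 * D + 1" using D_ge_2 by simp
  with C(2) show thesis using bound by (rule that)
qed

text \<open>\<open>card_rises_le\<close> needs rises twice as large as the counted falls, hence the
  constant \<open>C\<^sup>2\<close>. It multiplies the count of falls by the range of the logarithm,
  which is bounded by a constant over x; this adds 1 to the exponent \<open>log 2 D\<close>.\<close>

lemma elastic_if_unit_transfer:
  assumes tr: "unit_transfer d M"
  shows "elastic_at_infinity F"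
proof -
  obtain C K where C: "C > 1" and K: "K > 0" and
    bound: "\<And>x P. 0 < x \<Longrightarrow> x \<le> 1 \<Longrightarrow> separated 1 P \<Longrightarrow>
    \<forall>p\<in>P. if d then C * \<phi> (snd p) x \<le> \<phi> (fst p) x else C * \<phi> (fst p) x \<le> \<phi> (snd p) x \<Longrightarrow>
    real (card P) \<le> K * x powr (- log 2 D)"
    using card_le_of_unit_transfer[OF tr] by blast
  define L where "L = ln C"
  have L: "0 < L" using C by (simp add: L_def)
  have p: "0 < log 2 D" using D_ge_2 by simp
  define A where "A = ln D + log 2 D"
  have A: "0 < A" unfolding A_def using D_ge_2 p by (intro add_pos_pos) auto
  \<comment> \<open>\<open>K\<close> serves the falls \<open>P1\<close>,
    \<open>(K + 1) * A / L\<close> the rises \<open>P2\<close>, and the summand 1 ensures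
    \<open>K'\<close> > 1.\<close>
  define K' where "K' = 1 + K + (K + 1) * A / L"
  have K': "1 < K'" using K A L by (simp add: K'_def add_pos_pos)
  have "real (card P) \<le> K' * x powr (- (log 2 D + 1))"
    if x: "0 < x" "x \<le> 1" and P: "separated 1 P" "\<forall>p\<in>P. oscillates F x (C\<^sup>2) p" for x P
  proof -
    \<comment> \<open>The sign turns the direction controlled by the transfer into the falls of
      \<open>g\<close>.\<close>
    define g where "g t = (if d then 1 else - 1) * ln (\<phi> t x)" for t
    define N where "N = K * x powr (- log 2 D)"
    \<comment> \<open>Bound for the range of the logarithm of \<open>\<phi> t x\<close> over t \<ge>
      1, read off from \<open>\<phi>_lower_bound\<close>.\<close>
    define R where "R = ln D - log 2 D * ln x"
    have pos: "0 < fst p" "0 < snd p" "0 < \<phi> (fst p) x" "0 < \<phi> (snd p) x"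
      if "p \<in> Q" "separated 1 Q" for p Q
    proof -
      show "0 < fst p" "0 < snd p" using that by (fastforce simp: separated_def)+
      then show "0 < \<phi> (fst p) x" "0 < \<phi> (snd p) x" using x by (auto intro: \<phi>_pos)
    qed
    have ln_le: "ln B \<le> ln u - ln w \<longleftrightarrow> B * w \<le> u" if "0 < B" "0 < u" "0 < w" for B u w :: real
    proof -
      have "ln (B * w) = ln B + ln w" using that by (simp add: ln_mult)
      moreover have "ln (B * w) \<le> ln u \<longleftrightarrow> B * w \<le> u" using that by (intro ln_le_cancel_iff) auto
      ultimately show ?thesis by linarith
    qed
    have falls: "real (card Q) \<le> N"
      if Q: "separated 1 Q" "\<And>p. p \<in> Q \<Longrightarrow> L \<le> g (fst p) - g (snd p)" for Q
      unfolding N_def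
    proof (rule bound[OF x Q(1)], rule ballI)
      fix p assume p: "p \<in> Q"
      show "if d then C * \<phi> (snd p) x \<le> \<phi> (fst p) x else C * \<phi> (fst p) x \<le> \<phi> (snd p) x"
        using Q(2)[OF p] pos[OF p Q(1)] C ln_le[of C "\<phi> (fst p) x" "\<phi> (snd p) x"]
          ln_le[of C "\<phi> (snd p) x" "\<phi> (fst p) x"] by (auto simp: g_def L_def)
    qed
    have ln_range: "- R \<le> ln (\<phi> t x)" "ln (\<phi> t x) \<le> 0" if "1 \<le> t" for t
    proof -
      have "x powr log 2 D / D \<le> \<phi> t x" using that x by (intro \<phi>_lower_bound) auto
      moreover have "0 < x powr log 2 D / D" using x D_ge_2 by simp
      ultimately have "ln (x powr log 2 D / D) \<le> ln (\<phi> t x)" using that x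
        by (subst ln_le_cancel_iff) (auto simp: \<phi>_pos)
      then show "- R \<le> ln (\<phi> t x)" using x D_ge_2 by (simp add: R_def ln_div ln_powr)
      show "ln (\<phi> t x) \<le> 0" using \<phi>_le[of t x] \<phi>_pos[of t x] that x by simp
    qed
    have g_range: "g s - g t \<le> R" if "1 \<le> s" "1 \<le> t" for s t
      using ln_range[OF that(1)] ln_range[OF that(2)] by (auto simp: g_def)
    define P1 where "P1 = {p\<in>P. 2 * L \<le> g (fst p) - g (snd p)}"
    define P2 where "P2 = {p\<in>P. 2 * L \<le> g (snd p) - g (fst p)}"
    have sep: "separated 1 P1" "separated 1 P2"
      by (rule separated_subset[OF P(1)]; auto simp: P1_def P2_def)+
    have "real (card P1) \<le> N" using L by (intro falls sep) (auto simp: P1_def)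
    moreover have "real (card P2) * L \<le> (N + 1) * R"
      using g_range L falls sep(2) by (rule card_rises_le) (auto simp: P2_def)
    moreover have "P = P1 \<union> P2"
    proof -
      have "p \<in> P1 \<or> p \<in> P2" if p: "p \<in> P" for p
      proof -
        have lnC: "ln (C\<^sup>2) = 2 * L" using C by (simp add: L_def ln_realpow)
        have C2: "0 < C\<^sup>2" using C by simp
        have "oscillates F x (C\<^sup>2) p" using P(2) p by blast
        then show ?thesis
          using p pos[OF p P(1)] ln_le[OF C2, of "\<phi> (fst p) x" "\<phi> (snd p) x"]
            ln_le[OF C2, of "\<phi> (snd p) x" "\<phi> (fst p) x"] lnC
          by (auto simp: P1_def P2_def oscillates_def g_def)
      qed
      then show ?thesis by (auto simp: P1_def P2_def)
    qed
    then have "real (card P) \<le> real (card P1) + real (card P2)"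
      using card_Un_le[of P1 P2] by (simp flip: of_nat_add)
    ultimately have card: "real (card P) \<le> N + (N + 1) * R / L"
      using L by (simp add: pos_le_divide_eq[symmetric])
    define y where "y = x powr (- log 2 D)"
    have y: "1 \<le> y" using x p powr_le1[of "log 2 D" x] by (simp add: y_def powr_minus field_simps)
    have x1: "1 \<le> 1 / x" using x by simp
    \<comment> \<open>A crude bound for the logarithm suffices, since the final exponent is
      arbitrary.\<close>
    have "- ln x \<le> 1 / x" using ln_le_minus_one[of "1 / x"] x by (simp add: ln_div)
    then have "log 2 D * (- ln x) \<le> log 2 D * (1 / x)" using p by (intro mult_left_mono) auto
    moreover have "ln D * 1 \<le> ln D * (1 / x)" using x1 D_ge_2 by (intro mult_left_mono) auto
    ultimately have R_le: "R \<le> A * (1 / x)" by (simp add: R_def A_def add_divide_distrib)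
    have R_nonneg: "0 \<le> R" using g_range[of 1 1] by simp
    have "N + 1 \<le> (K + 1) * y" using y by (simp add: N_def y_def distrib_right)
    then have "(N + 1) * R \<le> ((K + 1) * y) * (A * (1 / x))"
      using R_le R_nonneg K y by (intro mult_mono) auto
    then have "(N + 1) * R / L \<le> ((K + 1) * A / L) * (y * (1 / x))"
      using divide_right_mono[of "(N + 1) * R" "((K + 1) * y) * (A * (1 / x))" L] L
      by (simp add: mult_ac)
    moreover have "N \<le> K * (y * (1 / x))"
    proof -
      have "K * (y * 1) \<le> K * (y * (1 / x))" using x1 y K by (intro mult_left_mono) auto
      then show ?thesis by (simp add: N_def y_def)
    qed
    moreover have "0 \<le> y * (1 / x)" using y x by simp
    moreover have "y * (1 / x) = x powr (- (log 2 D + 1))"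
      using x by (simp add: y_def powr_diff powr_minus)
    ultimately show ?thesis using card by (simp only: K'_def distrib_right)
  qed
  then have "bounded_oscillation F 1 (C\<^sup>2) K' (log 2 D + 1)"
    unfolding bounded_oscillation_def by blast
  moreover have "1 < C\<^sup>2" using C by (simp add: one_less_power)
  moreover have "0 < log 2 D + 1" using p by simp
  ultimately show ?thesis using K' elastic_at_infinity_iff by blast
qed

end

theorem theorem6p6:
  fixes F :: "real \<Rightarrow> real"
  assumes "orlicz_function F" and "delta2 F"
  shows "(elastic_at_infinity F \<longleftrightarrow> stretchable (orlicz_norm F)) \<and>
         (elastic_at_infinity F \<longleftrightarrow> compressible (orlicz_norm F)) \<and>
         (elastic_at_infinity F \<longleftrightarrow> elastic_space (orlicz_norm F))"
proof -
  obtain D where "\<forall>x\<ge>0. F (2 * x) \<le> D * F x" using assms(2) by (auto simp: delta2_def)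
  then interpret orlicz_delta2 F D using assms(1) by unfold_locales auto
  have "elastic_at_infinity F \<longleftrightarrow> stretchable (orlicz_norm F)"
    using stretchable_if_elastic unit_transfer_if_stretchable elastic_if_unit_transfer by blast
  moreover have "elastic_at_infinity F \<longleftrightarrow> compressible (orlicz_norm F)"
    using compressible_if_elastic unit_transfer_if_compressible elastic_if_unit_transfer by blast
  ultimately show ?thesis by (auto simp: elastic_space_def)
qed

end
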